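(* Let $\mathcal{D}=(\Omega,\mathcal{B})$ be a supersimple $2$-$(n,4,\lambda)$ design satisfying property $(\triangle)$, and let $\mathcal{E}:=\{[a,b]\mid a,b\in\Omega\}$ be the set of elementary moves on $\mathcal{D}$. Let $\mathcal{C}$ be the set of collinear triples of $\mathcal{D}$ and suppose that $(\Omega,\mathcal{C})$ is a regular two-graph. Then, for $\infty\in\Omega$, $(\mathcal{L}_\infty(\mathcal{D}),\mathcal{E})$ is a $3$-transposition group and, for some positive integer $m$, one of the following holds: (a) $n=2^m$ and $\mathcal{L}_\infty(\mathcal{D})\cong(\mathbb{F}_2)^m$; (b) $n=2^{m-1}(2^m\pm1)$ and $\mathcal{L}_\infty(\mathcal{D})\cong\operatorname{Sp}_{2m}(2)$; (c) $n=2^{2m}$ and $\mathcal{L}_\infty(\mathcal{D})\cong 2^{2m}.\operatorname{Sp}_{2m}(2)$.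
   Context: A $2$-$(n,4,\lambda)$ design $(\Omega,\mathcal{B})$ consists of a set $\Omega$ of $n$ points and a multiset $\mathcal{B}$ of $4$-subsets (lines) such that every $2$-subset of $\Omega$ lies in exactly $\lambda$ lines; it is supersimple if any two distinct lines meet in at most two points. For distinct $a,b$, if $\{a,b,a_i,b_i\}$ ($1\le i\le\lambda$) are the lines through $a,b$, the elementary move is $[a,b]:=(a,b)\prod_{i=1}^\lambda(a_i,b_i)\in\operatorname{Sym}(\Omega)$; $[a,a]:=1$. Permutations act on the right, products composed left to right; $[a_0,\dots,a_k]:=[a_0,a_1][a_1,a_2]\cdots[a_{k-1},a_k]$. For $\infty\in\Omega$, $\mathcal{L}_\infty(\mathcal{D})$ is the set of all move sequences $[\infty,a_1,\dots,a_k]$ ($k\ge1$). Property $(\triangle)$: whenever $B_1,B_2\in\mathcal{B}$ with $|B_1\cap B_2|=2$, the symmetric difference $B_1\triangle B_2$ lies in $\mathcal{B}$. A collinear triple is a $3$-subset contained in a line. $(\Omega,\mathcal{C})$ is a regular two-graph if it is a $2$-$(n,3,\mu)$ design and every $4$-subset of $\Omega$ contains exactly $0$, $2$ or $4$ members of $\mathcal{C}$. A $3$-transposition group is a pair $(G,\mathcal{E})$ with $G$ a group and $\mathcal{E}$ a set of involutions of $G$ such that $G=\langle\mathcal{E}\rangle$, $\mathcal{E}$ is a union of $G$-conjugacy classes, and $gh$ has order $1$, $2$ or $3$ for all $g,h\in\mathcal{E}$. $2^{2m}.\operatorname{Sp}_{2m}(2)$ denotes a group with an elementary abelian normal subgroup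 of order $2^{2m}$ and quotient isomorphic to $\operatorname{Sp}_{2m}(2)$.
   Formalization: The set of elementary moves is taken over distinct points a, b only, since [a,a]=1 is not an involution, and the design is assumed to have at least one line, since with no lines (e.g. n=5, λ=0) the group is Sym(n) and the claim fails. *)

theory Defs
  imports "HOL-Algebra.Algebra"
begin

text \<open>A 2-(n,4,lam) design on the finite point set Omega with block set B
  (n = card Omega).  Blocks are modelled as a set of 4-subsets; for a supersimple
  design this loses nothing, since two copies of a block would be distinct lines
  meeting in 4 points.  We require B to be nonempty (nontrivial design).\<close>
definition design_2_4 :: "'a set \<Rightarrow> 'a set set \<Rightarrow> nat \<Rightarrow> bool" where
  "design_2_4 \<Omega> B lam \<longleftrightarrow> finite \<Omega> \<and> B \<noteq> {} \<and>
     (\<forall>L\<in>B. L \<subseteq> \<Omega> \<and> card L = 4) \<and>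
     (\<forall>a\<in>\<Omega>. \<forall>b\<in>\<Omega>. a \<noteq> b \<longrightarrow> card {L\<in>B. {a, b} \<subseteq> L} = lam)"

definition supersimple :: "'a set set \<Rightarrow> bool" where
  "supersimple B \<longleftrightarrow> (\<forall>L1\<in>B. \<forall>L2\<in>B. L1 \<noteq> L2 \<longrightarrow> card (L1 \<inter> L2) \<le> 2)"

definition prop_triangle :: "'a set set \<Rightarrow> bool" where
  "prop_triangle B \<longleftrightarrow>
     (\<forall>L1\<in>B. \<forall>L2\<in>B. card (L1 \<inter> L2) = 2 \<longrightarrow> (L1 - L2) \<union> (L2 - L1) \<in> B)"

definition collinear_triples :: "'a set set \<Rightarrow> 'a set set" where
  "collinear_triples B = {T. card T = 3 \<and> (\<exists>L\<in>B. T \<subseteq> L)}"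

definition regular_two_graph :: "'a set \<Rightarrow> 'a set set \<Rightarrow> bool" where
  "regular_two_graph \<Omega> C \<longleftrightarrow> finite \<Omega> \<and>
     (\<forall>T\<in>C. T \<subseteq> \<Omega> \<and> card T = 3) \<and>
     (\<exists>\<mu>. \<forall>a\<in>\<Omega>. \<forall>b\<in>\<Omega>. a \<noteq> b \<longrightarrow> card {T\<in>C. {a, b} \<subseteq> T} = \<mu>) \<and>
     (\<forall>Q. Q \<subseteq> \<Omega> \<and> card Q = 4 \<longrightarrow> card {T\<in>C. T \<subseteq> Q} \<in> {0, 2, 4})"

text \<open>The elementary move [a,b] = (a,b) * prod_i (a_i,b_i), where {a,b,a_i,b_i} are
  the lines through a and b; written out pointwise (the transpositions are disjoint
  in a supersimple design).  [a,a] = identity.  Points outside Omega are fixed.\<close>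
definition elem_move :: "'a set set \<Rightarrow> 'a \<Rightarrow> 'a \<Rightarrow> 'a \<Rightarrow> 'a" where
  "elem_move B a b x =
     (if a = b then x
      else if x = a then b
      else if x = b then a
      else if (\<exists>L\<in>B. {a, b, x} \<subseteq> L) then (THE y. \<exists>L\<in>B. L = {a, b, x, y})
      else x)"

text \<open>Move sequences [a0,...,ak] = [a0,a1][a1,a2]...; permutations act on the right and
  products are composed left to right, so the function of g*h is h o g.\<close>
fun move_seq :: "'a set set \<Rightarrow> 'a list \<Rightarrow> 'a \<Rightarrow> 'a" where
  "move_seq B [] = id"
| "move_seq B [a] = id"
| "move_seq B (a # b # rest) = move_seq B (b # rest) \<circ> elem_move B a b"

definition L_inf :: "'a set \<Rightarrow> 'a set set \<Rightarrow> 'a \<Rightarrow> ('a \<Rightarrow> 'a) set" where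
  "L_inf \<Omega> B pinf = {move_seq B (pinf # as) | as. as \<noteq> [] \<and> set as \<subseteq> \<Omega>}"

definition elem_moves :: "'a set \<Rightarrow> 'a set set \<Rightarrow> ('a \<Rightarrow> 'a) set" where
  "elem_moves \<Omega> B = {elem_move B a b | a b. a \<in> \<Omega> \<and> b \<in> \<Omega> \<and> a \<noteq> b}"

definition L_group :: "'a set \<Rightarrow> 'a set set \<Rightarrow> 'a \<Rightarrow> ('a \<Rightarrow> 'a) monoid" where
  "L_group \<Omega> B pinf = \<lparr>carrier = L_inf \<Omega> B pinf, monoid.mult = (\<lambda>g h. h \<circ> g), monoid.one = id\<rparr>"

definition three_transposition_group :: "('g, 'b) monoid_scheme \<Rightarrow> 'g set \<Rightarrow> bool" where
  "three_transposition_group G E \<longleftrightarrow>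
     group G \<and> E \<subseteq> carrier G \<and>
     (\<forall>e\<in>E. e \<noteq> \<one>\<^bsub>G\<^esub> \<and> e \<otimes>\<^bsub>G\<^esub> e = \<one>\<^bsub>G\<^esub>) \<and>
     generate G E = carrier G \<and>
     (\<forall>g\<in>carrier G. \<forall>e\<in>E. inv\<^bsub>G\<^esub> g \<otimes>\<^bsub>G\<^esub> e \<otimes>\<^bsub>G\<^esub> g \<in> E) \<and>
     (\<forall>g\<in>E. \<forall>h\<in>E. group.ord G (g \<otimes>\<^bsub>G\<^esub> h) \<in> {1, 2, 3})"

definition F2vec :: "nat \<Rightarrow> (nat \<Rightarrow> bool) set" where
  "F2vec k = {v. \<forall>i\<ge>k. \<not> v i}"

definition vadd :: "(nat \<Rightarrow> bool) \<Rightarrow> (nat \<Rightarrow> bool) \<Rightarrow> nat \<Rightarrow> bool" where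
  "vadd v w = (\<lambda>i. v i \<noteq> w i)"

definition F2_group :: "nat \<Rightarrow> (nat \<Rightarrow> bool) monoid" where
  "F2_group k = \<lparr>carrier = F2vec k, monoid.mult = vadd, monoid.one = (\<lambda>_. False)\<rparr>"

text \<open>Standard nondegenerate alternating form on (F_2)^(2m):
  B(v,w) = sum_{i<m} (v_i w_{m+i} + v_{m+i} w_i) mod 2.\<close>
definition sympl_form :: "nat \<Rightarrow> (nat \<Rightarrow> bool) \<Rightarrow> (nat \<Rightarrow> bool) \<Rightarrow> bool" where
  "sympl_form m v w = odd (card {i. i < m \<and> ((v i \<and> w (m + i)) \<noteq> (v (m + i) \<and> w i))})"

text \<open>Sp_{2m}(2): bijective additive (= F_2-linear) maps of (F_2)^(2m) preserving the
  form, extended by the identity outside the vector space, under composition.\<close>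
definition Sp_group :: "nat \<Rightarrow> ((nat \<Rightarrow> bool) \<Rightarrow> (nat \<Rightarrow> bool)) monoid" where
  "Sp_group m = \<lparr>carrier = {f. bij_betw f (F2vec (2*m)) (F2vec (2*m)) \<and>
        (\<forall>x. x \<notin> F2vec (2*m) \<longrightarrow> f x = x) \<and>
        (\<forall>v\<in>F2vec (2*m). \<forall>w\<in>F2vec (2*m). f (vadd v w) = vadd (f v) (f w)) \<and>
        (\<forall>v\<in>F2vec (2*m). \<forall>w\<in>F2vec (2*m). sympl_form m (f v) (f w) = sympl_form m v w)},
     monoid.mult = (\<circ>), monoid.one = id\<rparr>"

definition is_2_2m_Sp :: "nat \<Rightarrow> ('g, 'b) monoid_scheme \<Rightarrow> bool" where
  "is_2_2m_Sp m G \<longleftrightarrow> (\<exists>N. N \<lhd> G \<and> (G\<lparr>carrier := N\<rparr>) \<cong> F2_group (2*m) \<and>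
                              (G Mod N) \<cong> Sp_group m)"

end

theory Submission
  imports Defs
begin

text \<open>
  Call a triple of points noncollinear if it lies in no line. The two-graph axiom says that
  noncollinearity is a 2-cocycle over \<open>F\<^sub>2\<close>, hence the coboundary of \<open>f a x\<close> = ``\<open>base\<close>, \<open>a\<close>, \<open>x\<close> are
  noncollinear''. By property (\<open>\<triangle>\<close>) the function \<open>f a + f b\<close> only depends on the class of the pair
  \<open>{a, b}\<close> modulo lines, and an elementary move \<open>[a, b]\<close> acts on the vectors \<open>f x\<close> as the affine
  transvection \<open>x \<mapsto> x + (1 + \<phi>(a + b, a + x)) (a + b)\<close>, where \<open>\<phi>(a + b, a + c)\<close> records whether
  \<open>a\<close>, \<open>b\<close>, \<open>c\<close> are noncollinear. If all triples are collinear, \<open>\<Omega>\<close> is itself an affine space over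
  \<open>F\<^sub>2\<close>. Otherwise regularity of the two-graph makes \<open>f\<close> injective, and a counting argument shows that
  the differences \<open>f a + f b\<close> form a whole symplectic space \<open>V\<close>. Thus all transvections of \<open>V\<close> occur as
  linear parts, and the linear part maps the group onto \<open>Sp(V)\<close> with kernel the translations
  preserving the image \<open>X\<close> of \<open>\<Omega>\<close>. If \<open>X\<close> has a nonzero period, then \<open>X = V\<close> and all translations
  occur. Otherwise, for every \<open>e\<close> the set of \<open>x \<in> X\<close> with \<open>x + e \<in> X\<close> is cut out by one of the two
  equations \<open>\<phi>(e, x) = q(e)\<close>; this \<open>q\<close> is a quadratic form polarising to \<open>\<phi>\<close> whose zero set is \<open>X\<close>.
\<close>

section \<open>Vectors over the field with two elements\<close>

definition xadd :: "('i \<Rightarrow> bool) \<Rightarrow> ('i \<Rightarrow> bool) \<Rightarrow> 'i \<Rightarrow> bool" (infixl "\<boxplus>" 65) where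
  "v \<boxplus> w = (\<lambda>i. v i \<noteq> w i)"

lemma xadd_apply [simp]: "(v \<boxplus> w) i \<longleftrightarrow> v i \<noteq> w i"
  by (simp add: xadd_def)

lemma vadd_eq_xadd: "vadd = (\<boxplus>)"
  by (simp add: fun_eq_iff vadd_def)

definition scale2 :: "bool \<Rightarrow> ('i \<Rightarrow> bool) \<Rightarrow> 'i \<Rightarrow> bool" where
  "scale2 b v = (\<lambda>i. b \<and> v i)"

lemma scale2_apply [simp]: "scale2 b v i \<longleftrightarrow> b \<and> v i"
  by (simp add: scale2_def)

lemma scale2_simps [simp]: "scale2 True v = v" "scale2 False v = (\<lambda>_. False)"
  by auto

lemma xadd_simps [simp]: "v \<boxplus> v = (\<lambda>_. False)" "v \<boxplus> (\<lambda>_. False) = v" "(\<lambda>_. False) \<boxplus> v = v"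
  by auto

lemma xadd_comm: "v \<boxplus> w = w \<boxplus> v"
  by auto

lemma xadd_assoc: "u \<boxplus> v \<boxplus> w = u \<boxplus> (v \<boxplus> w)"
  by auto

lemma xadd_left_cancel [simp]: "v \<boxplus> (v \<boxplus> w) = w"
  by auto

lemma xadd_inj [simp]: "u \<boxplus> v = u \<boxplus> w \<longleftrightarrow> v = w"
  by (metis xadd_left_cancel)

lemma xadd_eq_zero [simp]: "v \<boxplus> w = (\<lambda>_. False) \<longleftrightarrow> v = w"
  by (metis xadd_left_cancel xadd_simps(2))

lemma zero_F2vec [simp]: "(\<lambda>_. False) \<in> F2vec k"
  by (simp add: F2vec_def)

lemma xadd_F2vec [simp]: "v \<in> F2vec k \<Longrightarrow> w \<in> F2vec k \<Longrightarrow> v \<boxplus> w \<in> F2vec k"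
  by (simp add: F2vec_def)

lemma scale2_F2vec [simp]: "v \<in> F2vec k \<Longrightarrow> scale2 b v \<in> F2vec k"
  by (simp add: F2vec_def)

lemma bij_betw_Pow_F2vec: "bij_betw (\<lambda>A i. i \<in> A) (Pow {..<k}) (F2vec k)"
proof (rule bij_betw_imageI)
  show "inj_on (\<lambda>A i. i \<in> A) (Pow {..<k})" by (auto simp: inj_on_def fun_eq_iff)
  show "(\<lambda>A i. i \<in> A) ` Pow {..<k} = F2vec k"
  proof (intro equalityI subsetI)
    fix v assume "v \<in> F2vec k"
    then have "{i. v i} \<in> Pow {..<k}" by (auto simp: F2vec_def not_le)
    then show "v \<in> (\<lambda>A i. i \<in> A) ` Pow {..<k}" by (rule rev_image_eqI) simp
  qed (auto simp: F2vec_def)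
qed

lemma finite_F2vec [simp]: "finite (F2vec k)"
  using bij_betw_finite[OF bij_betw_Pow_F2vec] by auto

lemma card_F2vec: "card (F2vec k) = 2 ^ k"
  using bij_betw_same_card[OF bij_betw_Pow_F2vec, of k] by (simp add: card_Pow)

section \<open>Parities and the standard symplectic form\<close>

definition parity :: "nat \<Rightarrow> (nat \<Rightarrow> bool) \<Rightarrow> bool" where
  "parity m P = odd (card {i. i < m \<and> P i})"

lemma parity_0 [simp]: "\<not> parity 0 P"
  by (simp add: parity_def)

lemma parity_Suc [simp]: "parity (Suc m) P \<longleftrightarrow> parity m P \<noteq> P m"
proof (cases "P m")
  case True
  then have "{i. i < Suc m \<and> P i} = insert m {i. i < m \<and> P i}" by (auto simp: less_Suc_eq)
  then show ?thesis using True by (simp add: parity_def)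
next
  case False
  then have "{i. i < Suc m \<and> P i} = {i. i < m \<and> P i}" by (auto simp: less_Suc_eq)
  then show ?thesis using False by (simp add: parity_def)
qed

lemma parity_xor: "parity m (\<lambda>i. P i \<noteq> Q i) \<longleftrightarrow> parity m P \<noteq> parity m Q"
  by (induction m) auto

lemma parity_cong: "(\<And>i. i < m \<Longrightarrow> P i = Q i) \<Longrightarrow> parity m P = parity m Q"
  by (induction m) auto

lemma parity_single: "j < m \<Longrightarrow> parity m (\<lambda>i. i = j \<and> P i) = P j"
proof (induction m)
  case (Suc m)
  have "{i. i < m \<and> i = m \<and> P i} = {}" by auto
  then have "\<not> parity m (\<lambda>i. i = m \<and> P i)" unfolding parity_def by (simp only: card.empty even_zero not_not)
  then show ?case using Suc by (cases "j = m") (auto simp: less_Suc_eq)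
qed simp

lemma sympl_form_parity:
  "sympl_form m v w = parity m (\<lambda>i. (v i \<and> w (m + i)) \<noteq> (v (m + i) \<and> w i))"
  by (simp add: sympl_form_def parity_def)

lemma sympl_form_add_left [simp]:
  "sympl_form m (u \<boxplus> v) w \<longleftrightarrow> sympl_form m u w \<noteq> sympl_form m v w"
  unfolding sympl_form_parity parity_xor[symmetric] by (rule parity_cong) auto

lemma sympl_form_sym: "sympl_form m v w = sympl_form m w v"
  unfolding sympl_form_parity by (rule parity_cong) auto

lemma sympl_form_add_right [simp]:
  "sympl_form m w (u \<boxplus> v) \<longleftrightarrow> sympl_form m w u \<noteq> sympl_form m w v"
  by (metis sympl_form_add_left sympl_form_sym)

lemma sympl_form_zero [simp]: "\<not> sympl_form m (\<lambda>_. False) w" "\<not> sympl_form m w (\<lambda>_. False)"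
  using sympl_form_add_left[of m w w w] sympl_form_add_right[of m w w w] by auto

lemma sympl_form_self [simp]: "\<not> sympl_form m v v"
proof -
  have "sympl_form m v v = parity m (\<lambda>_. False)"
    unfolding sympl_form_parity by (rule parity_cong) auto
  then show ?thesis by (simp add: parity_def)
qed

lemma sympl_form_scale [simp]: "sympl_form m (scale2 b v) w \<longleftrightarrow> b \<and> sympl_form m v w"
  "sympl_form m v (scale2 b w) \<longleftrightarrow> b \<and> sympl_form m v w"
  by (cases b; simp)+

text \<open>The witness is the unit vector at the partner of a coordinate \<open>i\<close> where
  \<open>v\<close> is nonzero: \<open>m + i\<close> in the lower half, \<open>i - m\<close> in the
  upper half.\<close>

lemma sympl_form_nondegenerate:
  assumes "v \<in> F2vec (2 * m)" "v \<noteq> (\<lambda>_. False)"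
  obtains w where "w \<in> F2vec (2 * m)" "sympl_form m v w"
proof -
  obtain i where i: "v i" using assms(2) by (auto simp: fun_eq_iff)
  then have "i < 2 * m" using assms(1) by (auto simp: F2vec_def) (meson linorder_not_le)
  show ?thesis
  proof (cases "i < m")
    case True
    have "sympl_form m v (\<lambda>j. j = m + i) = parity m (\<lambda>j. j = i \<and> v j)"
      unfolding sympl_form_parity by (rule parity_cong) (use True in auto)
    then show ?thesis using True i parity_single[of i m v] by (intro that[of "\<lambda>j. j = m + i"]) (auto simp: F2vec_def)
  next
    case False
    then have "sympl_form m v (\<lambda>j. j = i - m) = parity m (\<lambda>j. j = i - m \<and> v (m + j))"
      unfolding sympl_form_parity using \<open>i < 2 * m\<close> by (intro parity_cong) auto
    then show ?thesis using False \<open>i < 2 * m\<close> i parity_single[of "i - m" m "\<lambda>j. v (m + j)"]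
      by (intro that[of "\<lambda>j. j = i - m"]) (auto simp: F2vec_def)
  qed
qed

section \<open>Coordinates for symplectic and elementary abelian spaces\<close>

text \<open>The new hyperbolic pair occupies the coordinates \<open>m\<close> and \<open>2m + 1\<close>, as \<^const>\<open>sympl_form\<close> pairs
  \<open>i\<close> with \<open>m + i\<close>.\<close>
definition hyp_insert :: "nat \<Rightarrow> bool \<Rightarrow> bool \<Rightarrow> (nat \<Rightarrow> bool) \<Rightarrow> nat \<Rightarrow> bool" where
  "hyp_insert m a b v = (\<lambda>i. if i < m then v i else if i = m then a
     else if i \<le> 2 * m then v (i - 1) else if i = 2 * m + 1 then b else False)"

lemma hyp_insert_F2vec: "hyp_insert m a b v \<in> F2vec (2 * Suc m)"
  by (auto simp: F2vec_def hyp_insert_def)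

lemma hyp_insert_add:
  "hyp_insert m (a \<noteq> a') (b \<noteq> b') (v \<boxplus> v') = hyp_insert m a b v \<boxplus> hyp_insert m a' b' v'"
  by (auto simp: hyp_insert_def fun_eq_iff)

lemma hyp_insert_eqD:
  assumes "hyp_insert m a b v = hyp_insert m a' b' v'" "v \<in> F2vec (2 * m)" "v' \<in> F2vec (2 * m)"
  shows "a = a'" "b = b'" "v = v'"
proof -
  note eq = fun_cong[OF assms(1)]
  show "a = a'" using eq[of m] by (simp add: hyp_insert_def)
  show "b = b'" using eq[of "2 * m + 1"] by (simp add: hyp_insert_def)
  show "v = v'"
  proof
    fix i
    consider "i < m" | "m \<le> i" "i < 2 * m" | "2 * m \<le> i" by linarith
    then show "v i = v' i"
    proof cases
      case 1
      then show ?thesis using eq[of i] by (simp add: hyp_insert_def)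
    next
      case 2
      then show ?thesis using eq[of "Suc i"] by (simp add: hyp_insert_def)
    next
      case 3
      then show ?thesis using assms(2,3) by (simp add: F2vec_def)
    qed
  qed
qed

lemma hyp_insert_surj:
  assumes "x \<in> F2vec (2 * Suc m)"
  obtains v where "v \<in> F2vec (2 * m)" "x = hyp_insert m (x m) (x (2 * m + 1)) v"
proof
  let ?v = "\<lambda>i. if i < m then x i else if i < 2 * m then x (i + 1) else False"
  show "?v \<in> F2vec (2 * m)" by (simp add: F2vec_def)
  show "x = hyp_insert m (x m) (x (2 * m + 1)) ?v"
  proof
    fix i
    consider "i < m" | "i = m" | "m < i" "i \<le> 2 * m" | "i = 2 * m + 1" | "2 * m + 2 \<le> i" by linarith
    then show "x i = hyp_insert m (x m) (x (2 * m + 1)) ?v i"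
      using assms by cases (auto simp: hyp_insert_def F2vec_def)
  qed
qed

text \<open>The inserted coordinates are partners of each other and contribute the determinant term.
  The old partners stay partners, because the upper half has moved up by one.\<close>

lemma sympl_form_hyp_insert:
  "sympl_form (Suc m) (hyp_insert m a b v) (hyp_insert m a' b' v')
    \<longleftrightarrow> (sympl_form m v v' \<noteq> ((a \<and> b') \<noteq> (b \<and> a')))"
proof -
  let ?x = "hyp_insert m a b v" and ?y = "hyp_insert m a' b' v'"
  have "parity m (\<lambda>i. (?x i \<and> ?y (Suc m + i)) \<noteq> (?x (Suc m + i) \<and> ?y i)) = sympl_form m v v'"
    unfolding sympl_form_parity by (rule parity_cong) (auto simp: hyp_insert_def)
  moreover have "?x m = a" "?x (Suc m + m) = b" "?y m = a'" "?y (Suc m + m) = b'"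
    by (auto simp: hyp_insert_def)
  ultimately show ?thesis by (simp add: sympl_form_parity)
qed

text \<open>Induction on the size of \<open>V\<close>: a nonzero \<open>u\<close> and some
  \<open>w\<close> with \<open>\<phi> u w\<close> span a hyperbolic plane, and the form stays
  nondegenerate on the orthogonal complement \<open>W\<close> of this plane.\<close>

lemma symplectic_coordinates:
  fixes V :: "('i \<Rightarrow> bool) set" and \<phi> :: "('i \<Rightarrow> bool) \<Rightarrow> ('i \<Rightarrow> bool) \<Rightarrow> bool"
  assumes "finite V" "(\<lambda>_. False) \<in> V" "\<And>v w. v \<in> V \<Longrightarrow> w \<in> V \<Longrightarrow> v \<boxplus> w \<in> V"
    and "\<And>u v w. u \<in> V \<Longrightarrow> v \<in> V \<Longrightarrow> w \<in> V \<Longrightarrow> \<phi> (u \<boxplus> v) w \<longleftrightarrow> \<phi> u w \<noteq> \<phi> v w"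
    and "\<And>v w. v \<in> V \<Longrightarrow> w \<in> V \<Longrightarrow> \<phi> v w \<longleftrightarrow> \<phi> w v"
    and "\<And>v. v \<in> V \<Longrightarrow> \<not> \<phi> v v"
    and "\<And>v. v \<in> V \<Longrightarrow> v \<noteq> (\<lambda>_. False) \<Longrightarrow> \<exists>w\<in>V. \<phi> v w"
  shows "\<exists>m h. bij_betw h V (F2vec (2 * m)) \<and> (\<forall>v\<in>V. \<forall>w\<in>V. h (v \<boxplus> w) = h v \<boxplus> h w)
    \<and> (\<forall>v\<in>V. \<forall>w\<in>V. sympl_form m (h v) (h w) = \<phi> v w)"
  using assms
proof (induction "card V" arbitrary: V rule: less_induct)
  case less
  note zero = less.prems(2) and add = less.prems(3) and lin = less.prems(4)
    and sym = less.prems(5) and alt = less.prems(6) and nondeg = less.prems(7)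
  show ?case
  proof (cases "V = {\<lambda>_. False}")
    case True
    have "F2vec (2 * 0) = {\<lambda>_. False}" by (auto simp: F2vec_def)
    then have "bij_betw (\<lambda>_ _. False) V (F2vec (2 * 0))" using True by (simp add: bij_betw_def)
    moreover have "\<not> \<phi> v w" if "v \<in> V" "w \<in> V" for v w
      using that True alt by simp
    ultimately show ?thesis by (intro exI[of _ 0] exI[of _ "\<lambda>_ _. False"]) (simp add: sympl_form_parity)
  next
    case False
    then obtain u where u: "u \<in> V" "u \<noteq> (\<lambda>_. False)" using zero by blast
    then obtain w where w: "w \<in> V" "\<phi> u w" using nondeg by blast
    then have wu: "\<phi> w u" using sym u by blast
    have scale: "scale2 b v \<in> V" if "v \<in> V" for b v
      using that zero by (cases b) auto
    have zero_l: "\<not> \<phi> (\<lambda>_. False) v" if "v \<in> V" for v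
      using lin[OF zero zero that] by simp
    have scale_l: "\<phi> (scale2 b v) x \<longleftrightarrow> b \<and> \<phi> v x" if "v \<in> V" "x \<in> V" for b v x
      using that zero_l by (cases b) auto
    have lin_r: "\<phi> x (v \<boxplus> y) \<longleftrightarrow> \<phi> x v \<noteq> \<phi> x y" if "v \<in> V" "x \<in> V" "y \<in> V" for v x y
      using lin[of v y x] sym add that by metis
    have scale_r: "\<phi> x (scale2 b v) \<longleftrightarrow> b \<and> \<phi> x v" if "v \<in> V" "x \<in> V" for b v x
      using scale_l[of v x b] sym scale that by metis
    define W where "W = {x \<in> V. \<not> \<phi> x u \<and> \<not> \<phi> x w}"
    \<comment> \<open>The orthogonal projection onto \<open>W\<close>. The coefficient of
      \<open>u\<close> in \<open>y\<close> is \<open>\<phi> y w\<close> and that of \<open>w\<close>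
      is \<open>\<phi> y u\<close>, since \<open>\<phi> u w\<close> holds.\<close>
    define p where "p y = y \<boxplus> scale2 (\<phi> y w) u \<boxplus> scale2 (\<phi> y u) w" for y
    note rules = lin lin_r scale scale_l scale_r add u(1) w wu alt
    have p_W: "p y \<in> W" if "y \<in> V" for y
      using that by (simp add: W_def p_def rules)
    have p_form: "\<phi> y z \<longleftrightarrow> (\<phi> (p y) (p z) \<noteq> ((\<phi> y w \<and> \<phi> z u) \<noteq> (\<phi> y u \<and> \<phi> z w)))"
      if "y \<in> V" "z \<in> V" for y z
      using that sym[of u z] sym[of w z] by (auto simp: p_def rules)
    have W_sub: "W \<subseteq> V" by (auto simp: W_def)
    have "u \<notin> W" using w by (simp add: W_def)
    then have card_W: "card W < card V"
      using less.prems(1) u(1) W_sub by (metis psubset_card_mono psubsetI)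
    have nondeg_W: "\<exists>y\<in>W. \<phi> v y" if v: "v \<in> W" "v \<noteq> (\<lambda>_. False)" for v
    proof -
      have "v \<in> V" "\<not> \<phi> v u" "\<not> \<phi> v w" using v by (auto simp: W_def)
      moreover obtain y where "y \<in> V" "\<phi> v y" using nondeg v W_sub by blast
      ultimately have "\<phi> v (p y)" by (simp add: p_def rules)
      then show ?thesis using p_W \<open>y \<in> V\<close> by blast
    qed
    have fin_W: "finite W" using less.prems(1) W_sub finite_subset by blast
    have zero_W: "(\<lambda>_. False) \<in> W" using zero zero_l u w by (simp add: W_def)
    have add_W: "v \<boxplus> y \<in> W" if "v \<in> W" "y \<in> W" for v y
      using that by (simp add: W_def rules)
    have lin_W: "\<phi> (x \<boxplus> y) t \<longleftrightarrow> \<phi> x t \<noteq> \<phi> y t" if "x \<in> W" "y \<in> W" "t \<in> W" for x y t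
      using lin[of x y t] W_sub that by auto
    have sym_W: "\<phi> x y = \<phi> y x" if "x \<in> W" "y \<in> W" for x y
      using sym[of x y] W_sub that by auto
    have alt_W: "\<not> \<phi> x x" if "x \<in> W" for x
      using alt W_sub that by auto
    have "\<exists>m h. bij_betw h W (F2vec (2 * m)) \<and> (\<forall>v\<in>W. \<forall>w\<in>W. h (v \<boxplus> w) = h v \<boxplus> h w)
      \<and> (\<forall>v\<in>W. \<forall>w\<in>W. sympl_form m (h v) (h w) = \<phi> v w)"
      by (rule less.hyps[OF card_W fin_W zero_W add_W lin_W sym_W alt_W nondeg_W])
    then obtain m h where h: "bij_betw h W (F2vec (2 * m))"
      and h_add: "\<And>v w. v \<in> W \<Longrightarrow> w \<in> W \<Longrightarrow> h (v \<boxplus> w) = h v \<boxplus> h w"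
      and h_form: "\<And>v w. v \<in> W \<Longrightarrow> w \<in> W \<Longrightarrow> sympl_form m (h v) (h w) = \<phi> v w"
      by blast
    define k where "k y = hyp_insert m (\<phi> y w) (\<phi> y u) (h (p y))" for y
    have h_in: "h v \<in> F2vec (2 * m)" if "v \<in> W" for v using h that bij_betwE by blast
    have "inj_on k V"
    proof (rule inj_onI)
      fix y z assume y: "y \<in> V" and z: "z \<in> V" and "k y = k z"
      then have eq: "\<phi> y w = \<phi> z w" "\<phi> y u = \<phi> z u" "h (p y) = h (p z)"
        using hyp_insert_eqD[of m "\<phi> y w" "\<phi> y u" "h (p y)" "\<phi> z w" "\<phi> z u" "h (p z)"] h_in p_W
        by (auto simp: k_def)
      then have "p y = p z" using h p_W y z by (metis bij_betw_inv_into_left)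
      then show "y = z" using eq by (auto simp: p_def fun_eq_iff)
    qed
    moreover have "k ` V = F2vec (2 * Suc m)"
    proof (intro equalityI subsetI)
      fix x assume "x \<in> F2vec (2 * Suc m)"
      then obtain v where v: "v \<in> F2vec (2 * m)" "x = hyp_insert m (x m) (x (2 * m + 1)) v"
        using hyp_insert_surj by blast
      then obtain t where t: "t \<in> W" "h t = v" using h by (metis bij_betw_imp_surj_on imageE)
      then have tV: "t \<in> V" "\<not> \<phi> t u" "\<not> \<phi> t w" by (auto simp: W_def)
      define y where "y = t \<boxplus> scale2 (x m) u \<boxplus> scale2 (x (2 * m + 1)) w"
      have y: "y \<in> V" "\<phi> y w = x m" "\<phi> y u = x (2 * m + 1)"
        using tV by (auto simp: y_def rules)
      then have "p y = t" by (auto simp: p_def y_def fun_eq_iff)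
      then show "x \<in> k ` V" using y v(2) t(2) by (intro image_eqI[of _ _ y]) (simp_all add: k_def)
    qed (auto simp: k_def hyp_insert_F2vec simp del: mult_Suc_right)
    ultimately have "bij_betw k V (F2vec (2 * Suc m))" by (simp add: bij_betw_def)
    moreover have "k (y \<boxplus> z) = k y \<boxplus> k z" if "y \<in> V" "z \<in> V" for y z
    proof -
      have "p (y \<boxplus> z) = p y \<boxplus> p z" using that by (auto simp: p_def rules fun_eq_iff)
      then show ?thesis using that p_W h_add by (simp add: k_def hyp_insert_add[symmetric] rules)
    qed
    moreover have "sympl_form (Suc m) (k y) (k z) = \<phi> y z" if "y \<in> V" "z \<in> V" for y z
      using p_form[OF that] p_W h_form that by (simp add: k_def sympl_form_hyp_insert)
    ultimately show ?thesis by blast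
  qed
qed

text \<open>F2-spaces of increasing dimension are embedded into \<open>V\<close> until this fails.
  The last embedding is onto, as an element outside its image could serve as the image of one more
  basis vector.\<close>

lemma elementary_abelian_coordinates:
  fixes V :: "'v set" and f :: "'v \<Rightarrow> 'v \<Rightarrow> 'v"
  assumes fin: "finite V" and zero: "z \<in> V" and closed: "\<And>x y. x \<in> V \<Longrightarrow> y \<in> V \<Longrightarrow> f x y \<in> V"
    and assoc: "\<And>x y w. x \<in> V \<Longrightarrow> y \<in> V \<Longrightarrow> w \<in> V \<Longrightarrow> f (f x y) w = f x (f y w)"
    and comm: "\<And>x y. x \<in> V \<Longrightarrow> y \<in> V \<Longrightarrow> f x y = f y x"
    and unit: "\<And>x. x \<in> V \<Longrightarrow> f z x = x" and inv: "\<And>x. x \<in> V \<Longrightarrow> f x x = z"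
  shows "\<exists>m h. bij_betw h V (F2vec m) \<and> (\<forall>x\<in>V. \<forall>y\<in>V. h (f x y) = h x \<boxplus> h y)"
proof -
  define P where "P k \<longleftrightarrow> (\<exists>g. inj_on g (F2vec k) \<and> g ` F2vec k \<subseteq> V
    \<and> (\<forall>x\<in>F2vec k. \<forall>y\<in>F2vec k. g (x \<boxplus> y) = f (g x) (g y)))" for k
  have "P 0"
    unfolding P_def by (rule exI[of _ "\<lambda>_. z"]) (use zero unit in \<open>auto simp: inj_on_def F2vec_def\<close>)
  moreover have "\<not> P (card V)"
  proof
    assume "P (card V)"
    then have "card (F2vec (card V)) \<le> card V" unfolding P_def using fin card_inj_on_le by blast
    then show False using less_exp[of "card V"] by (simp add: card_F2vec)
  qed
  ultimately obtain k where "P k" "\<not> P (Suc k)"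
    by (metis nat_induct)
  then obtain g where g: "inj_on g (F2vec k)" "g ` F2vec k \<subseteq> V"
    and g_add: "\<And>x y. x \<in> F2vec k \<Longrightarrow> y \<in> F2vec k \<Longrightarrow> g (x \<boxplus> y) = f (g x) (g y)"
    unfolding P_def by blast
  have cancel: "f x (f x y) = y" if "x \<in> V" "y \<in> V" for x y
    using that assoc[of x x y] inv unit by simp
  have comm4: "f (f a b) (f c d) = f (f a c) (f b d)" if "a \<in> V" "b \<in> V" "c \<in> V" "d \<in> V" for a b c d
    using that assoc closed comm by metis
  have "V \<subseteq> g ` F2vec k"
  proof (rule ccontr)
    assume "\<not> V \<subseteq> g ` F2vec k"
    then obtain v where v: "v \<in> V" "v \<notin> g ` F2vec k" by blast
    define c where "c b = (if b then v else z)" for b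
    define r where "r x = x(k := False)" for x :: "nat \<Rightarrow> bool"
    \<comment> \<open>The new coordinate \<open>k\<close> is sent to \<open>v\<close>, and
      \<open>r\<close> forgets it.\<close>
    define g' where "g' x = f (g (r x)) (c (x k))" for x
    have r: "r x \<in> F2vec k" if "x \<in> F2vec (Suc k)" for x
      using that by (auto simp: F2vec_def r_def)
    have c: "c b \<in> V" "f (c a) (c b) = c (a \<noteq> b)" for a b
      using v zero inv unit comm by (auto simp: c_def)
    have gr: "g (r x) \<in> V" if "x \<in> F2vec (Suc k)" for x using r[OF that] g(2) by blast
    have add: "g' (x \<boxplus> y) = f (g' x) (g' y)" if "x \<in> F2vec (Suc k)" "y \<in> F2vec (Suc k)" for x y
    proof -
      have "r (x \<boxplus> y) = r x \<boxplus> r y" by (auto simp: r_def fun_eq_iff)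
      then show ?thesis
        using that r g_add comm4[OF gr gr c(1) c(1), of x y "x k" "y k"] by (simp add: g'_def c(2))
    qed
    have "inj_on g' (F2vec (Suc k))"
    proof (rule inj_onI)
      fix x y assume x: "x \<in> F2vec (Suc k)" and y: "y \<in> F2vec (Suc k)" and "g' x = g' y"
      then have "g' (x \<boxplus> y) = z" using add inv closed gr c by (simp add: g'_def)
      then have 1: "f (g (r (x \<boxplus> y))) (c ((x \<boxplus> y) k)) = z" by (simp add: g'_def)
      have xy: "x \<boxplus> y \<in> F2vec (Suc k)" using x y by simp
      have 2: "g (r (x \<boxplus> y)) = c ((x \<boxplus> y) k)"
        using 1 cancel[OF gr[OF xy] c(1)] unit comm zero gr[OF xy] by metis
      have "\<not> (x \<boxplus> y) k" using 2 v r[OF xy] by (auto simp: c_def)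
      then have "g (r (x \<boxplus> y)) = z" using 2 by (simp add: c_def)
      moreover have "g (\<lambda>_. False) = z"
      proof -
        have "g (\<lambda>_. False) \<in> V" using g(2) zero_F2vec by (rule subsetD[OF _ imageI])
        then show ?thesis using g_add[of "\<lambda>_. False" "\<lambda>_. False"] inv by simp
      qed
      ultimately have "r (x \<boxplus> y) = (\<lambda>_. False)"
        using inj_onD[OF g(1) _ r[OF xy] zero_F2vec] by simp
      then have "\<not> (x \<boxplus> y) i" for i
        using \<open>\<not> (x \<boxplus> y) k\<close> by (metis fun_upd_apply r_def)
      then show "x = y" by auto
    qed
    moreover have "g' ` F2vec (Suc k) \<subseteq> V" using gr c closed by (auto simp: g'_def)
    ultimately have "P (Suc k)" unfolding P_def using add by blast
    then show False using \<open>\<not> P (Suc k)\<close> by simp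
  qed
  then have bij: "bij_betw g (F2vec k) V" using g by (simp add: bij_betw_def subset_antisym)
  define h where "h = inv_into (F2vec k) g"
  have h: "bij_betw h V (F2vec k)" unfolding h_def by (rule bij_betw_inv_into[OF bij])
  moreover have "h (f x y) = h x \<boxplus> h y" if "x \<in> V" "y \<in> V" for x y
  proof -
    have hx: "h x \<in> F2vec k" "h y \<in> F2vec k" using h that bij_betwE by blast+
    then have "f x y = g (h x \<boxplus> h y)"
      using that bij g_add by (simp add: h_def bij_betw_inv_into_right)
    then show ?thesis using bij hx by (simp add: h_def bij_betw_inv_into_left)
  qed
  ultimately show ?thesis by blast
qed

section \<open>Symplectic groups and quadrics\<close>

text \<open>Extended by the identity outside the space, as all members of \<open>Sp_group\<close>
  are.\<close>

definition transv :: "nat \<Rightarrow> (nat \<Rightarrow> bool) \<Rightarrow> (nat \<Rightarrow> bool) \<Rightarrow> nat \<Rightarrow> bool" where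
  "transv m e v = (if v \<in> F2vec (2 * m) then v \<boxplus> scale2 (sympl_form m e v) e else v)"

lemma Sp_carrierI:
  assumes "bij_betw f (F2vec (2 * m)) (F2vec (2 * m))" "\<And>x. x \<notin> F2vec (2 * m) \<Longrightarrow> f x = x"
    "\<And>v w. v \<in> F2vec (2 * m) \<Longrightarrow> w \<in> F2vec (2 * m) \<Longrightarrow> f (v \<boxplus> w) = f v \<boxplus> f w"
    "\<And>v w. v \<in> F2vec (2 * m) \<Longrightarrow> w \<in> F2vec (2 * m) \<Longrightarrow> sympl_form m (f v) (f w) = sympl_form m v w"
  shows "f \<in> carrier (Sp_group m)"
  using assms by (simp add: Sp_group_def vadd_eq_xadd)

lemma Sp_carrierD:
  assumes "f \<in> carrier (Sp_group m)"
  shows "bij_betw f (F2vec (2 * m)) (F2vec (2 * m))" "\<And>x. x \<notin> F2vec (2 * m) \<Longrightarrow> f x = x"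
    "\<And>v w. v \<in> F2vec (2 * m) \<Longrightarrow> w \<in> F2vec (2 * m) \<Longrightarrow> f (v \<boxplus> w) = f v \<boxplus> f w"
    "\<And>v w. v \<in> F2vec (2 * m) \<Longrightarrow> w \<in> F2vec (2 * m) \<Longrightarrow> sympl_form m (f v) (f w) = sympl_form m v w"
    "\<And>v. v \<in> F2vec (2 * m) \<Longrightarrow> f v \<in> F2vec (2 * m)"
  using assms bij_betwE by (auto simp: Sp_group_def vadd_eq_xadd)

lemma Sp_mult [simp]: "f \<otimes>\<^bsub>Sp_group m\<^esub> g = f \<circ> g" "\<one>\<^bsub>Sp_group m\<^esub> = id"
  by (simp_all add: Sp_group_def)

lemma Sp_comp_closed:
  assumes "f \<in> carrier (Sp_group m)" "g \<in> carrier (Sp_group m)"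
  shows "f \<circ> g \<in> carrier (Sp_group m)"
  by (rule Sp_carrierI) (use Sp_carrierD[OF assms(1)] Sp_carrierD[OF assms(2)] in
      \<open>auto intro: bij_betw_trans\<close>)

lemma Sp_id_closed: "id \<in> carrier (Sp_group m)"
  by (rule Sp_carrierI) auto

lemma Sp_inverse:
  assumes "f \<in> carrier (Sp_group m)"
  obtains g where "g \<in> carrier (Sp_group m)" "g \<circ> f = id" "f \<circ> g = id"
proof
  note f = Sp_carrierD[OF assms]
  let ?V = "F2vec (2 * m)"
  define g where "g x = (if x \<in> ?V then inv_into ?V f x else x)" for x
  have gf: "g (f x) = x" for x
    using f(1,2,5) by (cases "x \<in> ?V") (auto simp: g_def bij_betw_inv_into_left)
  have fg: "f (g x) = x" for x
    using f(1,2) by (cases "x \<in> ?V") (auto simp: g_def bij_betw_inv_into_right)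
  have g_in: "g v \<in> ?V" if "v \<in> ?V" for v
    using bij_betwE[OF bij_betw_inv_into[OF f(1)]] that by (auto simp: g_def)
  show "g \<in> carrier (Sp_group m)"
  proof (rule Sp_carrierI)
    show "bij_betw g ?V ?V"
      using bij_betw_inv_into[OF f(1)] by (rule bij_betw_cong[THEN iffD1, rotated]) (simp add: g_def)
    show "g x = x" if "x \<notin> ?V" for x using that by (simp add: g_def)
    show "g (v \<boxplus> w) = g v \<boxplus> g w" if "v \<in> ?V" "w \<in> ?V" for v w
      using f(3)[OF g_in g_in, OF that] gf fg by metis
    show "sympl_form m (g v) (g w) = sympl_form m v w" if "v \<in> ?V" "w \<in> ?V" for v w
      using f(4)[OF g_in g_in, OF that] fg by simp
  qed
  show "g \<circ> f = id" "f \<circ> g = id" using gf fg by auto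
qed

lemma group_Sp: "group (Sp_group m)"
proof (rule groupI)
  fix x assume "x \<in> carrier (Sp_group m)"
  then show "\<exists>y\<in>carrier (Sp_group m). y \<otimes>\<^bsub>Sp_group m\<^esub> x = \<one>\<^bsub>Sp_group m\<^esub>"
    using Sp_inverse by (metis Sp_mult)
qed (auto simp: Sp_comp_closed Sp_id_closed comp_assoc)

lemma transv_F2vec [simp]: "v \<in> F2vec (2 * m) \<Longrightarrow> e \<in> F2vec (2 * m) \<Longrightarrow> transv m e v \<in> F2vec (2 * m)"
  by (simp add: transv_def)

lemma transv_invol:
  assumes "e \<in> F2vec (2 * m)" shows "transv m e (transv m e v) = v"
  using assms by (auto simp: transv_def fun_eq_iff)

lemma transv_Sp:
  assumes e: "e \<in> F2vec (2 * m)" shows "transv m e \<in> carrier (Sp_group m)"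
proof (rule Sp_carrierI)
  show "bij_betw (transv m e) (F2vec (2 * m)) (F2vec (2 * m))"
    by (rule bij_betw_byWitness[where f' = "transv m e"]) (use e transv_invol in auto)
  show "transv m e (v \<boxplus> w) = transv m e v \<boxplus> transv m e w"
    if "v \<in> F2vec (2 * m)" "w \<in> F2vec (2 * m)" for v w
    using that by (auto simp: transv_def fun_eq_iff)
  show "sympl_form m (transv m e v) (transv m e w) = sympl_form m v w"
    if "v \<in> F2vec (2 * m)" "w \<in> F2vec (2 * m)" for v w
    using that sympl_form_sym[of m v e] by (auto simp: transv_def)
qed (simp add: transv_def)

section \<open>Generation of the symplectic group by transvections\<close>

definition moved :: "nat \<Rightarrow> ((nat \<Rightarrow> bool) \<Rightarrow> nat \<Rightarrow> bool) \<Rightarrow> (nat \<Rightarrow> bool) set" where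
  "moved m f = {v \<in> F2vec (2 * m). f v \<noteq> v}"

text \<open>A fixed vector \<open>x\<close> of \<open>f\<close> has the same product with
  \<open>v\<close> as with \<open>f v\<close>. It is therefore orthogonal to \<open>v + f v\<close>,
  and the transvection fixes it as well.\<close>

lemma moved_transv_subset:
  assumes "f \<in> carrier (Sp_group m)" "v \<in> F2vec (2 * m)"
  shows "moved m (transv m (v \<boxplus> f v) \<circ> f) \<subseteq> moved m f"
proof
  fix x assume x: "x \<in> moved m (transv m (v \<boxplus> f v) \<circ> f)"
  note f = Sp_carrierD[OF assms(1)]
  have "f x \<noteq> x"
  proof
    assume "f x = x"
    moreover have "x \<in> F2vec (2 * m)" using x by (simp add: moved_def)
    ultimately have "transv m (v \<boxplus> f v) (f x) = x"
      using f(4)[OF assms(2), of x] by (simp add: transv_def)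
    then show False using x by (simp add: moved_def)
  qed
  then show "x \<in> moved m f" using x by (simp add: moved_def)
qed

text \<open>If \<open>v\<close> and \<open>f v\<close> are not orthogonal, the transvection along
  their sum takes \<open>f v\<close> back to \<open>v\<close>, so \<open>v\<close> becomes a new
  fixed vector.\<close>

lemma moved_transv_psubset:
  assumes "f \<in> carrier (Sp_group m)" "v \<in> F2vec (2 * m)" "sympl_form m v (f v)"
  shows "moved m (transv m (v \<boxplus> f v) \<circ> f) \<subset> moved m f"
proof -
  note f = Sp_carrierD[OF assms(1)]
  have "transv m (v \<boxplus> f v) (f v) = v"
    using assms f(5)[OF assms(2)] by (auto simp: transv_def fun_eq_iff)
  moreover have "f v \<noteq> v" using assms(3) by auto
  ultimately show ?thesis
    using moved_transv_subset[OF assms(1,2)] assms(2) by (auto simp: moved_def)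
qed

text \<open>Induction on the number of moved vectors. If some chosen \<open>w\<close> is not
  orthogonal to its image, one transvection lowers this number. Otherwise a preliminary transvection
  along \<open>e = v + f v\<close>, which moves no additional vectors, makes \<open>w\<close>
  nonorthogonal to its image.\<close>

lemma Sp_transv_induct [consumes 1, case_names id transv]:
  assumes "f \<in> carrier (Sp_group m)" and id: "P id"
    and step: "\<And>e f. e \<in> F2vec (2 * m) \<Longrightarrow> e \<noteq> (\<lambda>_. False) \<Longrightarrow> f \<in> carrier (Sp_group m) \<Longrightarrow> P f
      \<Longrightarrow> P (transv m e \<circ> f)"
  shows "P f"
  using assms(1)
proof (induction "card (moved m f)" arbitrary: f rule: less_induct)
  case less
  let ?V = "F2vec (2 * m)"
  note f = Sp_carrierD[OF less.prems]
  have fin: "finite (moved m g)" for g by (simp add: moved_def)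
  \<comment> \<open>Transvections are involutions, so the induction step also removes a
    transvection.\<close>
  have undo: "P g" if "P (transv m e \<circ> g)" "g \<in> carrier (Sp_group m)" "e \<in> ?V" "e \<noteq> (\<lambda>_. False)" for e g
  proof -
    have "P (transv m e \<circ> (transv m e \<circ> g))"
      using that(1) by (rule step[OF that(3,4) Sp_comp_closed[OF transv_Sp[OF that(3)] that(2)]])
    moreover have "transv m e \<circ> (transv m e \<circ> g) = g"
      by (rule ext) (simp add: transv_invol that(3))
    ultimately show ?thesis by simp
  qed
  have reduce: "P g" if g: "g \<in> carrier (Sp_group m)" and sub: "moved m g \<subseteq> moved m f"
    and v: "v \<in> ?V" "sympl_form m v (g v)" for g v
  proof (rule undo[of "v \<boxplus> g v"])
    have e: "v \<boxplus> g v \<in> ?V" using v Sp_carrierD(5)[OF g] by simp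
    have "card (moved m (transv m (v \<boxplus> g v) \<circ> g)) < card (moved m f)"
      using moved_transv_psubset[OF g v] sub fin by (intro psubset_card_mono) auto
    then show "P (transv m (v \<boxplus> g v) \<circ> g)"
      by (rule less.hyps) (intro Sp_comp_closed transv_Sp e g)
    show "v \<boxplus> g v \<noteq> (\<lambda>_. False)" using v(2) by auto
  qed (use g v Sp_carrierD(5)[OF g] in auto)
  show ?case
  proof (cases "moved m f = {}")
    case True
    then have "f x = x" for x using f(2) by (cases "x \<in> ?V") (auto simp: moved_def)
    then have "f = id" by auto
    then show ?thesis using id by simp
  next
    case False
    then obtain v where v: "v \<in> ?V" "f v \<noteq> v" by (auto simp: moved_def)
    define e where "e = v \<boxplus> f v"
    have e: "e \<in> ?V" "e \<noteq> (\<lambda>_. False)" using v f(5) by (auto simp: e_def)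
    \<comment> \<open>With \<open>a\<close> not orthogonal to \<open>e\<close> and \<open>b\<close>
      the preimage of \<open>a\<close> under \<open>f\<close>, one of \<open>a\<close>,
      \<open>b\<close> and \<open>a + b\<close> has the desired property.\<close>
    obtain w where w: "w \<in> ?V" "sympl_form m e w" "sympl_form m e (f w)"
    proof -
      obtain a where a: "a \<in> ?V" "sympl_form m e a" using sympl_form_nondegenerate e by blast
      then obtain b where b: "b \<in> ?V" "f b = a" using f(1) by (metis bij_betw_imp_surj_on imageE)
      consider "sympl_form m e (f a)" | "sympl_form m e b" | "\<not> sympl_form m e (f a)" "\<not> sympl_form m e b"
        by blast
      then show ?thesis
      proof cases
        case 3
        then have "sympl_form m e (a \<boxplus> b)" "sympl_form m e (f (a \<boxplus> b))"
          using a b f(3)[OF a(1) b(1)] by auto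
        then show ?thesis using that[of "a \<boxplus> b"] a b by simp
      qed (use that a b in auto)
    qed
    show ?thesis
    proof (cases "sympl_form m w (f w)")
      case True
      then show ?thesis using reduce[OF less.prems _ w(1)] by simp
    next
      case False
      have "P (transv m e \<circ> f)"
      proof (rule reduce)
        show "transv m e \<circ> f \<in> carrier (Sp_group m)" using e less.prems by (intro Sp_comp_closed transv_Sp)
        show "moved m (transv m e \<circ> f) \<subseteq> moved m f"
          using moved_transv_subset[OF less.prems v(1)] by (simp add: e_def)
        show "w \<in> ?V" by (rule w(1))
        show "sympl_form m w ((transv m e \<circ> f) w)"
          using False w f(5) sympl_form_sym[of m w e] by (simp add: transv_def)
      qed
      then show ?thesis using undo less.prems e by blast
    qed
  qed
qed

section \<open>Counting the zeros of a quadratic form\<close>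

lemma sum_sign_sympl_form:
  assumes "w \<in> F2vec (2 * m)" "w \<noteq> (\<lambda>_. False)"
  shows "(\<Sum>v\<in>F2vec (2 * m). if sympl_form m v w then -1 else 1 :: int) = 0"
proof -
  let ?s = "\<lambda>v. if sympl_form m v w then -1 else 1 :: int"
  obtain u where u: "u \<in> F2vec (2 * m)" "sympl_form m w u" using sympl_form_nondegenerate assms by blast
  \<comment> \<open>Translation by a vector \<open>u\<close> not orthogonal to \<open>w\<close>
    flips every sign, so the sum equals its negative.\<close>
  have "bij_betw (\<lambda>v. u \<boxplus> v) (F2vec (2 * m)) (F2vec (2 * m))"
    by (rule bij_betw_byWitness[where f' = "\<lambda>v. u \<boxplus> v"]) (use u in auto)
  then have "(\<Sum>v\<in>F2vec (2 * m). ?s v) = (\<Sum>v\<in>F2vec (2 * m). ?s (u \<boxplus> v))"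
    by (rule sum.reindex_bij_betw[symmetric])
  also have "\<dots> = (\<Sum>v\<in>F2vec (2 * m). - ?s v)"
    using u(2) sympl_form_sym[of m u w] by (intro sum.cong) auto
  finally show ?thesis by (simp add: sum_negf)
qed

text \<open>The sign sum of a nondegenerate quadratic form squares to \<open>2\<^bsup>2m\<^esup>\<close>.\<close>
lemma card_quadric:
  assumes q: "\<And>v w. v \<in> F2vec (2 * m) \<Longrightarrow> w \<in> F2vec (2 * m) \<Longrightarrow>
      q (v \<boxplus> w) \<longleftrightarrow> (q v \<noteq> (q w \<noteq> sympl_form m v w))" and "m > 0"
  shows "card {v \<in> F2vec (2 * m). \<not> q v} = 2 ^ (m - 1) * (2 ^ m + 1)
    \<or> card {v \<in> F2vec (2 * m). \<not> q v} = 2 ^ (m - 1) * (2 ^ m - 1)"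
proof -
  let ?V = "F2vec (2 * m)"
  define \<epsilon> where "\<epsilon> b = (if b then -1 else 1 :: int)" for b
  define s where "s = (\<Sum>v\<in>?V. \<epsilon> (q v))"
  let ?Z = "{v \<in> ?V. \<not> q v}"
  have \<epsilon>: "\<epsilon> a * \<epsilon> b = \<epsilon> (a \<noteq> b)" for a b by (simp add: \<epsilon>_def)
  have q0: "\<not> q (\<lambda>_. False)" using q[of "\<lambda>_. False" "\<lambda>_. False"] by simp
  have shift: "bij_betw (\<lambda>w. v \<boxplus> w) ?V ?V" if "v \<in> ?V" for v
    by (rule bij_betw_byWitness[where f' = "\<lambda>w. v \<boxplus> w"]) (use that in auto)
  have "s * s = (\<Sum>v\<in>?V. \<Sum>w\<in>?V. \<epsilon> (q v) * \<epsilon> (q w))"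
    unfolding s_def by (rule sum_product)
  \<comment> \<open>After this substitution the quadratic identity leaves a character sum over
    \<open>v\<close>, which vanishes unless \<open>w\<close> is zero.\<close>
  also have "\<dots> = (\<Sum>v\<in>?V. \<Sum>w\<in>?V. \<epsilon> (q v) * \<epsilon> (q (v \<boxplus> w)))"
    by (intro sum.cong refl sum.reindex_bij_betw[OF shift, symmetric])
  also have "\<dots> = (\<Sum>v\<in>?V. \<Sum>w\<in>?V. \<epsilon> (q w) * \<epsilon> (sympl_form m v w))"
    by (intro sum.cong refl) (auto simp: \<epsilon> q \<epsilon>_def)
  also have "\<dots> = (\<Sum>w\<in>?V. \<epsilon> (q w) * (\<Sum>v\<in>?V. \<epsilon> (sympl_form m v w)))"
    by (subst sum.swap) (simp add: sum_distrib_left)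
  also have "\<dots> = (\<Sum>w\<in>?V. if w = (\<lambda>_. False) then int (card ?V) else 0)"
    using sum_sign_sympl_form[of _ m] q0 by (intro sum.cong refl) (auto simp: \<epsilon>_def)
  also have "\<dots> = (2 ^ m)\<^sup>2" by (simp add: card_F2vec power_mult[symmetric] mult.commute)
  finally have s_val: "s = 2 ^ m \<or> s = - (2 ^ m)" by (metis power2_eq_iff power2_eq_square)
  define c d where "c = card ?Z" and "d = card (?V - ?Z)"
  have s_eq: "s = int c - int d"
  proof -
    have "s = (\<Sum>v\<in>?Z. \<epsilon> (q v)) + (\<Sum>v\<in>?V - ?Z. \<epsilon> (q v))"
      unfolding s_def by (subst sum.subset_diff[of ?Z]) auto
    also have "\<dots> = (\<Sum>v\<in>?Z. 1) + (\<Sum>v\<in>?V - ?Z. - 1)"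
      by (intro arg_cong2[where f = "(+)"] sum.cong) (auto simp: \<epsilon>_def)
    finally show ?thesis by (simp add: c_def d_def)
  qed
  have "d + c = 2 ^ (2 * m)"
  proof -
    have "card ?Z \<le> card ?V" by (rule card_mono) auto
    moreover have "card (?V - ?Z) = card ?V - card ?Z" by (rule card_Diff_subset) auto
    ultimately show ?thesis unfolding c_def d_def card_F2vec[symmetric] by linarith
  qed
  then have "int d + int c = 2 ^ (2 * m)" by (metis of_nat_add of_nat_numeral of_nat_power)
  moreover have "y + x = n \<Longrightarrow> 2 * x = n + (x - y)" for x y n :: int by simp
  ultimately have c: "2 * int c = 2 ^ (2 * m) + s" unfolding s_eq by blast
  obtain k where k: "m = Suc k" using \<open>m > 0\<close> gr0_implies_Suc by blast
  have "2 * m = Suc (k + m)" using k by simp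
  then have pow: "(2::int) ^ (2 * m) = 2 * (2 ^ k * 2 ^ m)" "(2::int) ^ m = 2 * 2 ^ k"
    by (simp_all only: power_Suc power_add k)
  have "2 * x = 2 * (t * (2 * t)) + y \<Longrightarrow> y = 2 * t \<or> y = - (2 * t) \<Longrightarrow>
      x = t * (2 * t + 1) \<or> x = t * (2 * t - 1)" for x y t :: int
    by (auto simp: algebra_simps)
  from this[of "int c" "2 ^ k" s] have "int c = 2 ^ k * (2 ^ m + 1) \<or> int c = 2 ^ k * (2 ^ m - 1)"
    using s_val c unfolding pow by blast
  then have "int c = int (2 ^ k * (2 ^ m + 1)) \<or> int c = int (2 ^ k * (2 ^ m - 1))"
    by (simp add: of_nat_diff distrib_left add.commute)
  then have "c = 2 ^ k * (2 ^ m + 1) \<or> c = 2 ^ k * (2 ^ m - 1)"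
    by (simp only: of_nat_eq_iff)
  then show ?thesis unfolding c_def k diff_Suc_1 .
qed

section \<open>Noncollinearity as a cocycle\<close>

locale two_graph_design =
  fixes \<Omega> :: "'a set" and B :: "'a set set" and base :: 'a
  assumes fin: "finite \<Omega>"
    and B_nonempty: "B \<noteq> {}"
    and line_sub: "L \<in> B \<Longrightarrow> L \<subseteq> \<Omega>"
    and line_card: "L \<in> B \<Longrightarrow> card L = 4"
    and supersimple: "supersimple B"
    and triangle: "prop_triangle B"
    and two_graph: "regular_two_graph \<Omega> (collinear_triples B)"
    and base_in: "base \<in> \<Omega>"
begin

text \<open>Degenerate triples count as collinear, so that noncollinearity is an alternating
  F2-valued cochain.\<close>

definition ncol :: "'a \<Rightarrow> 'a \<Rightarrow> 'a \<Rightarrow> bool" where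
  "ncol a b c \<longleftrightarrow> a \<noteq> b \<and> a \<noteq> c \<and> b \<noteq> c \<and> \<not> (\<exists>L\<in>B. {a, b, c} \<subseteq> L)"

lemma ncol_swap: "ncol a b c \<longleftrightarrow> ncol b a c" "ncol a b c \<longleftrightarrow> ncol a c b" 
  by (auto simp: ncol_def insert_commute)

lemma ncol_refl [simp]: "\<not> ncol a a b" "\<not> ncol a b a" "\<not> ncol b a a"
  by (auto simp: ncol_def)

lemma line_eqI:
  assumes "L \<in> B" "M \<in> B" "{a, b, c} \<subseteq> L" "{a, b, c} \<subseteq> M" "distinct [a, b, c]"
  shows "L = M"
proof (rule ccontr)
  assume "L \<noteq> M"
  then have "card (L \<inter> M) \<le> 2"
    using supersimple assms unfolding supersimple_def by blast
  moreover have "finite (L \<inter> M)"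
    using line_card[OF assms(1)] by (metis card.infinite finite_Int zero_neq_numeral)
  then have "card {a, b, c} \<le> card (L \<inter> M)"
    using assms by (intro card_mono) auto
  ultimately show False using assms(5) by auto
qed

lemma line_distinct:
  assumes "{a, b, c, d} \<in> B" shows "distinct [a, b, c, d]"
  by (rule card_distinct) (use line_card[OF assms] in simp)

lemma line_points:
  assumes "{a, b, c, d} \<in> B" shows "a \<in> \<Omega>" "b \<in> \<Omega>" "c \<in> \<Omega>" "d \<in> \<Omega>"
  using line_sub[OF assms] by auto

lemma fourth_point:
  assumes "distinct [a, b, c]" "\<not> ncol a b c"
  obtains d where "{a, b, c, d} \<in> B"
proof -
  obtain L where L: "L \<in> B" "{a, b, c} \<subseteq> L" using assms by (auto simp: ncol_def)
  have "finite L" using line_card[OF L(1)] by (metis card.infinite zero_neq_numeral)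
  then have "card (L - {a, b, c}) = 1"
    using line_card[OF L(1)] L(2) assms(1) by (subst card_Diff_subset) auto
  then obtain d where "L - {a, b, c} = {d}" by (meson card_1_singletonE)
  then have "L = {a, b, c, d}" using L(2) by blast
  then show ?thesis using L(1) that by simp
qed

lemma ncolD: "ncol a b c \<Longrightarrow> L \<in> B \<Longrightarrow> {a, b, c} \<subseteq> L \<Longrightarrow> False"
  unfolding ncol_def by blast

lemma line_collinear:
  assumes "{a, b, c, d} \<in> B" shows "\<not> ncol a b c"
  using ncolD[OF _ assms] by auto

text \<open>The only use of property (\<open>\<triangle>\<close>).\<close>
lemma lines_symdiff:
  assumes "{a, b, c, d} \<in> B" "{a, b, x, y} \<in> B" "{c, d} \<noteq> {x, y}"
  shows "{c, d, x, y} \<in> B"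
proof -
  note d1 = line_distinct[OF assms(1)] and d2 = line_distinct[OF assms(2)]
  have ne: "{a, b, c, d} \<noteq> {a, b, x, y}" using assms(3) d1 d2 by (auto simp: doubleton_eq_iff set_eq_iff)
  have 1: "x \<notin> {c, d}"
    using line_eqI[OF assms(1,2), of a b x] ne d2 by auto
  have 2: "y \<notin> {c, d}"
    using line_eqI[OF assms(1,2), of a b y] ne d2 by auto
  have "{a, b, c, d} \<inter> {a, b, x, y} = {a, b}" using 1 2 d1 d2 by auto
  then have "card ({a, b, c, d} \<inter> {a, b, x, y}) = 2" using d1 by simp
  then have "({a, b, c, d} - {a, b, x, y}) \<union> ({a, b, x, y} - {a, b, c, d}) \<in> B"
    using triangle assms unfolding prop_triangle_def by blast
  moreover have "({a, b, c, d} - {a, b, x, y}) \<union> ({a, b, x, y} - {a, b, c, d}) = {c, d, x, y}"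
    using 1 2 d1 d2 by auto
  ultimately show ?thesis by simp
qed

lemma triples_of_quadruple:
  assumes "distinct [a, b, c, d]"
  shows "{T. T \<subseteq> {a, b, c, d} \<and> card T = 3} = {{a, b, c}, {a, b, d}, {a, c, d}, {b, c, d}}"
proof (intro equalityI subsetI)
  fix T assume T: "T \<in> {T. T \<subseteq> {a, b, c, d} \<and> card T = 3}"
  then have "finite T" using finite_subset by blast
  then have "card ({a, b, c, d} - T) = 1"
    using T assms by (subst card_Diff_subset) auto
  then obtain x where x: "{a, b, c, d} - T = {x}" by (meson card_1_singletonE)
  then have "T = {a, b, c, d} - {x}" "x \<in> {a, b, c, d}" using T by auto
  then show "T \<in> {{a, b, c}, {a, b, d}, {a, c, d}, {b, c, d}}"
    using assms by auto
qed (use assms in auto)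

lemma collinear_triple_iff:
  assumes "distinct [a, b, c]"
  shows "{a, b, c} \<in> collinear_triples B \<longleftrightarrow> \<not> ncol a b c"
  using assms by (auto simp: collinear_triples_def ncol_def)

text \<open>The number of collinear triples in a 4-set is even, hence so is the number of
  noncollinear ones. For repeated points the identity follows from the symmetry of
  \<open>ncol\<close>.\<close>

lemma ncol_cocycle:
  assumes "a \<in> \<Omega>" "b \<in> \<Omega>" "c \<in> \<Omega>" "d \<in> \<Omega>"
  shows "ncol b c d \<longleftrightarrow> (ncol a b c \<noteq> (ncol a b d \<noteq> ncol a c d))"
proof (cases "distinct [a, b, c, d]")
  case True
  let ?C = "collinear_triples B"
  let ?Q = "{a, b, c, d}"
  have "\<forall>Q. Q \<subseteq> \<Omega> \<and> card Q = 4 \<longrightarrow> card {T\<in>?C. T \<subseteq> Q} \<in> {0, 2, 4}"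
    using two_graph unfolding regular_two_graph_def by blast
  moreover have "?Q \<subseteq> \<Omega>" "card ?Q = 4" using assms True by simp_all
  ultimately have "card {T\<in>?C. T \<subseteq> ?Q} \<in> {0, 2, 4}" by blast
  moreover have "{T\<in>?C. T \<subseteq> ?Q} = {T. T \<subseteq> ?Q \<and> card T = 3} \<inter> ?C"
    by (auto simp: collinear_triples_def)
  ultimately have ev: "card ({{a, b, c}, {a, b, d}, {a, c, d}, {b, c, d}} \<inter> ?C) \<in> {0, 2, 4}"
    by (simp only: triples_of_quadruple[OF True])
  have card4: "card ({p, q, r, s} \<inter> Y) = of_bool (p \<in> Y) + of_bool (q \<in> Y) + of_bool (r \<in> Y) + of_bool (s \<in> Y)"
    if "p \<noteq> q" "p \<noteq> r" "p \<noteq> s" "q \<noteq> r" "q \<noteq> s" "r \<noteq> s" for p q r s :: "'a set" and Y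
    using that by (simp add: Int_insert_left)
  have "card ({{a, b, c}, {a, b, d}, {a, c, d}, {b, c, d}} \<inter> ?C)
      = of_bool (\<not> ncol a b c) + of_bool (\<not> ncol a b d) + of_bool (\<not> ncol a c d) + of_bool (\<not> ncol b c d)"
    using True by (subst card4) (auto simp: collinear_triple_iff)
  with ev have "of_bool (\<not> ncol a b c) + of_bool (\<not> ncol a b d) + of_bool (\<not> ncol a c d)
      + of_bool (\<not> ncol b c d) \<in> {0, 2, 4::nat}" by (simp only:)
  then show ?thesis
    by (cases "ncol a b c"; cases "ncol a b d"; cases "ncol a c d"; cases "ncol b c d"; simp)
next
  case False
  then consider "a = b" | "a = c" | "a = d" | "b = c" | "b = d" | "c = d" by auto
  then show ?thesis
    using ncol_swap(1)[of b c d] ncol_swap(2)[of c b d] ncol_swap(1)[of d b c]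
      ncol_swap(2)[of b d c] ncol_swap(2)[of a d c] by cases simp_all
qed

text \<open>\<open>S\<close> is \<open>\<mu> + 2\<close>, where \<mu> is the parameter of the
  two-graph: \<open>a\<close> and \<open>b\<close> themselves count as collinear with
  \<open>a\<close> and \<open>b\<close>. Some line exists, hence \<mu> is positive.\<close>

lemma collinear_count:
  obtains S where "S > 2" "\<And>a b. a \<in> \<Omega> \<Longrightarrow> b \<in> \<Omega> \<Longrightarrow> a \<noteq> b \<Longrightarrow> card {y\<in>\<Omega>. \<not> ncol a b y} = S"
proof -
  let ?C = "collinear_triples B"
  have "\<exists>\<mu>. \<forall>a\<in>\<Omega>. \<forall>b\<in>\<Omega>. a \<noteq> b \<longrightarrow> card {T\<in>?C. {a, b} \<subseteq> T} = \<mu>"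
    using two_graph unfolding regular_two_graph_def by (elim conjE)
  then obtain \<mu> where \<mu>: "a \<in> \<Omega> \<Longrightarrow> b \<in> \<Omega> \<Longrightarrow> a \<noteq> b \<Longrightarrow> card {T\<in>?C. {a, b} \<subseteq> T} = \<mu>" for a b
    by (elim exE) (rule that, simp)
  have triple_sub: "T \<subseteq> \<Omega>" if "T \<in> ?C" for T
    using that line_sub by (auto simp: collinear_triples_def)
  have C: "card {y\<in>\<Omega>. \<not> ncol a b y} = \<mu> + 2" if ab: "a \<in> \<Omega>" "b \<in> \<Omega>" "a \<noteq> b" for a b
  proof -
    let ?Y = "{y\<in>\<Omega>. \<not> ncol a b y} - {a, b}"
    have "bij_betw (\<lambda>y. {a, b, y}) ?Y {T\<in>?C. {a, b} \<subseteq> T}"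
    proof (rule bij_betwI')
      fix x y assume "x \<in> ?Y" "y \<in> ?Y"
      then show "({a, b, x} = {a, b, y}) = (x = y)" by auto
    next
      fix x assume "x \<in> ?Y"
      then show "{a, b, x} \<in> {T\<in>?C. {a, b} \<subseteq> T}"
        using collinear_triple_iff[of a b x] ab by auto
    next
      fix T assume T: "T \<in> {T\<in>?C. {a, b} \<subseteq> T}"
      then have cT: "card T = 3" by (auto simp: collinear_triples_def)
      then have "finite T" by (metis card.infinite zero_neq_numeral)
      then have "card (T - {a, b}) = 1"
        using T ab cT by (subst card_Diff_subset) auto
      then obtain y where y: "T - {a, b} = {y}" by (meson card_1_singletonE)
      then have Ty: "T = {a, b, y}" "y \<notin> {a, b}" using T by auto
      moreover have "y \<in> \<Omega>"
        using T Ty(1) triple_sub by blast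
      ultimately show "\<exists>y\<in>?Y. T = {a, b, y}"
        using T collinear_triple_iff[of a b y] ab by auto
    qed
    then have "card ?Y = card {T\<in>?C. {a, b} \<subseteq> T}" by (rule bij_betw_same_card)
    then have "card ?Y = \<mu>" by (simp only: \<mu>[OF ab])
    moreover have "card ?Y = card {y\<in>\<Omega>. \<not> ncol a b y} - card {a, b}"
      using ab fin by (intro card_Diff_subset) auto
    moreover have "card {a, b} \<le> card {y\<in>\<Omega>. \<not> ncol a b y}"
      using ab fin by (intro card_mono) auto
    ultimately show ?thesis using ab by auto
  qed
  obtain L where L: "L \<in> B" using B_nonempty by blast
  obtain a b c where abc: "{a, b, c} \<subseteq> L" "distinct [a, b, c]"
  proof -
    have "3 \<le> card L" using line_card[OF L] by simp
    then obtain T where "T \<subseteq> L" "card T = 3" by (rule obtain_subset_with_card_n)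
    then show ?thesis using that by (auto simp: card_3_iff)
  qed
  then have "a \<in> \<Omega>" "b \<in> \<Omega>" "c \<in> \<Omega>" using line_sub[OF L] by auto
  moreover have "\<not> ncol a b c" using abc L by (auto simp: ncol_def)
  ultimately have "card {a, b, c} \<le> card {y\<in>\<Omega>. \<not> ncol a b y}"
    using abc fin by (intro card_mono) auto
  then have "\<mu> + 2 > 2" using C[OF \<open>a \<in> \<Omega>\<close> \<open>b \<in> \<Omega>\<close>] abc by auto
  then show ?thesis using C that by blast
qed

section \<open>Elementary moves at single points\<close>

lemma elem_move_line:
  assumes "{a, b, x, y} \<in> B" shows "elem_move B a b x = y"
proof -
  note d = line_distinct[OF assms]
  \<comment> \<open>Supersimplicity makes the description unique: two lines through
    \<open>a\<close>, \<open>b\<close>, \<open>x\<close> coincide.\<close>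
  have "(THE y. \<exists>L\<in>B. L = {a, b, x, y}) = y"
  proof (rule the_equality)
    fix z assume "\<exists>L\<in>B. L = {a, b, x, z}"
    then have z: "{a, b, x, z} \<in> B" by simp
    then have "{a, b, x, y} = {a, b, x, z}"
      using line_eqI[OF assms z, of a b x] d by auto
    then show "z = y" using d line_distinct[OF z] by auto
  qed (use assms in auto)
  moreover have "\<exists>L\<in>B. {a, b, x} \<subseteq> L"
    by (rule bexI[OF _ assms]) simp
  ultimately show ?thesis using d unfolding elem_move_def by auto
qed

lemma elem_move_ncol: "ncol a b x \<Longrightarrow> elem_move B a b x = x"
  by (auto simp: elem_move_def ncol_def)

lemma elem_move_outside:
  assumes "a \<in> \<Omega>" "b \<in> \<Omega>" "x \<notin> \<Omega>" shows "elem_move B a b x = x"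
  using assms line_sub by (fastforce simp: elem_move_def)

lemma elem_move_collinear_cases:
  assumes "a \<noteq> b" "\<not> ncol a b x"
  obtains "x = a" "elem_move B a b x = b" | "x = b" "elem_move B a b x = a"
    | y where "{a, b, x, y} \<in> B" "elem_move B a b x = y"
proof -
  consider "x = a" | "x = b" | "distinct [a, b, x]" using assms by auto
  then show ?thesis
  proof cases
    case 3
    then obtain y where "{a, b, x, y} \<in> B" using assms fourth_point by blast
    then show ?thesis using elem_move_line that by blast
  qed (use assms that in \<open>auto simp: elem_move_def\<close>)
qed

section \<open>Difference vectors of pairs of points\<close>

definition fn :: "'a \<Rightarrow> 'a \<Rightarrow> bool" where
  "fn a = (\<lambda>x. x \<in> \<Omega> \<and> ncol base a x)"

definition dif :: "'a \<Rightarrow> 'a \<Rightarrow> 'a \<Rightarrow> bool" where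
  "dif a b = fn a \<boxplus> fn b"

lemma dif_rules: "dif a a = (\<lambda>_. False)" "dif a b = dif b a" "dif a b \<boxplus> dif b c = dif a c"
  by (auto simp: dif_def)

lemma fn_sym: "a \<in> \<Omega> \<Longrightarrow> b \<in> \<Omega> \<Longrightarrow> fn a b \<longleftrightarrow> fn b a"
  using ncol_swap(2)[of base a b] by (auto simp: fn_def)

lemma fn_self [simp]: "\<not> fn a a" "\<not> fn a base" "\<not> fn base a"
  by (auto simp: fn_def)

text \<open>The cocycle identity with \<open>base\<close> as extra point: the cone over
  \<open>base\<close> writes \<open>ncol\<close> as the coboundary of \<open>fn\<close>.\<close>

lemma ncol_fn:
  assumes "a \<in> \<Omega>" "b \<in> \<Omega>" "c \<in> \<Omega>"
  shows "ncol a b c \<longleftrightarrow> (fn a b \<noteq> (fn a c \<noteq> fn b c))"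
  using ncol_cocycle[OF base_in assms] assms by (auto simp: fn_def)

lemma dif_ncol:
  assumes "a \<in> \<Omega>" "b \<in> \<Omega>" "c \<in> \<Omega>"
  shows "dif a b c \<longleftrightarrow> (dif a b a \<noteq> ncol a b c)"
  using ncol_fn[OF assms] fn_sym[OF assms(1,2)] by (auto simp: dif_def)

lemma dif_outside: "x \<notin> \<Omega> \<Longrightarrow> \<not> dif a b x"
  by (auto simp: dif_def fn_def)

lemma dif_base: "\<not> dif a b base"
  by (auto simp: dif_def)

text \<open>By \<open>dif_ncol\<close> the two vectors agree up to a constant on \<Omega>. The
  constant is zero because both vanish at \<open>base\<close>.\<close>

lemma dif_eqI:
  assumes "\<And>x. x \<in> \<Omega> \<Longrightarrow> ncol a b x \<longleftrightarrow> ncol c d x"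
    and "a \<in> \<Omega>" "b \<in> \<Omega>" "c \<in> \<Omega>" "d \<in> \<Omega>"
  shows "dif a b = dif c d"
proof
  fix x show "dif a b x = dif c d x"
  proof (cases "x \<in> \<Omega>")
    case True
    then show ?thesis
      using assms(1)[OF True] assms(1)[OF base_in] dif_base[of a b] dif_base[of c d] assms(2-)
        dif_ncol[of a b x] dif_ncol[of c d x] dif_ncol[of a b base] dif_ncol[of c d base] base_in
      by auto
  qed (simp add: dif_outside)
qed

text \<open>A further line through \<open>a\<close>, \<open>b\<close> and \<open>x\<close> has with
  the given one a symmetric difference that is a line through \<open>c\<close>, \<open>d\<close> and
  \<open>x\<close>.\<close>

lemma line_ncol_imp:
  assumes "{a, b, c, d} \<in> B" "\<not> ncol a b x"
  shows "\<not> ncol c d x"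
proof (cases "x \<in> {a, b, c, d}")
  case True
  have "\<not> ncol c d a" "\<not> ncol c d b" using ncolD[OF _ assms(1)] by auto
  then show ?thesis using True by auto
next
  case False
  moreover have "a \<noteq> b" using line_distinct[OF assms(1)] by simp
  ultimately obtain y where y: "{a, b, x, y} \<in> B" using assms(2) fourth_point[of a b x] by auto
  have "{c, d, x, y} \<in> B" using lines_symdiff[OF assms(1) y] False by (auto simp: doubleton_eq_iff)
  then show ?thesis using line_collinear by blast
qed

lemma line_dif:
  assumes "{a, b, c, d} \<in> B" shows "dif a b = dif c d"
proof -
  have "{c, d, a, b} \<in> B" using assms by (simp add: insert_commute)
  then show ?thesis
    using assms line_ncol_imp line_points[OF assms] by (intro dif_eqI) blast+
qed

text \<open>The fourth point of the line through \<open>a\<close>, \<open>b\<close>,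
  \<open>c\<close> serves as \<open>d\<close>: opposite pairs of a line have the same
  difference.\<close>

lemma dif_shift:
  assumes "a \<in> \<Omega>" "b \<in> \<Omega>" "c \<in> \<Omega>" "\<not> ncol a b c"
  obtains d where "d \<in> \<Omega>" "dif a b = dif c d"
proof -
  consider "a = b" | "c = a" | "c = b" | "distinct [a, b, c]" by auto
  then show ?thesis
  proof cases
    case 4
    then obtain d where "{a, b, c, d} \<in> B" using assms fourth_point by blast
    then show ?thesis using that[of d] line_dif line_points by blast
  qed (use that assms dif_rules in metis)+
qed

definition difs :: "('a \<Rightarrow> bool) set" where
  "difs = {dif a b | a b. a \<in> \<Omega> \<and> b \<in> \<Omega>}"

text \<open>Both differences can be shifted to start at \<open>x\<close>; then their sum is the
  difference of the two end points.\<close>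

lemma difs_sum_collinear:
  assumes "a \<in> \<Omega>" "b \<in> \<Omega>" "c \<in> \<Omega>" "d \<in> \<Omega>" "x \<in> \<Omega>"
    and "\<not> ncol a b x" "\<not> ncol c d x"
  shows "dif a b \<boxplus> dif c d \<in> difs"
proof -
  obtain y where y: "y \<in> \<Omega>" "dif a b = dif x y" using assms dif_shift by blast
  obtain z where z: "z \<in> \<Omega>" "dif c d = dif x z" using assms dif_shift by blast
  have "dif a b \<boxplus> dif c d = dif y z" unfolding y z using dif_rules(2,3) by metis
  then show ?thesis using y z by (auto simp: difs_def)
qed

text \<open>The values at \<open>c\<close> and \<open>d\<close> differ, so one of these points is
  collinear with \<open>a\<close> and \<open>b\<close>. It serves as the common point of the two
  pairs.\<close>

lemma difs_sum_odd:
  assumes "a \<in> \<Omega>" "b \<in> \<Omega>" "c \<in> \<Omega>" "d \<in> \<Omega>" "dif a b c \<noteq> dif a b d"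
  shows "dif a b \<boxplus> dif c d \<in> difs"
proof -
  have "\<not> ncol a b c \<or> \<not> ncol a b d"
    using assms dif_ncol[of a b c] dif_ncol[of a b d] by auto
  then show ?thesis using assms difs_sum_collinear[of a b c d] ncol_refl by metis
qed

section \<open>Closure of the differences under addition\<close>

text \<open>A violation of closedness of the differences under addition; it is a set of four mutually
  noncollinear points.\<close>
definition bad :: "'a \<Rightarrow> 'a \<Rightarrow> 'a \<Rightarrow> 'a \<Rightarrow> bool" where
  "bad a b c d \<longleftrightarrow> a \<in> \<Omega> \<and> b \<in> \<Omega> \<and> c \<in> \<Omega> \<and> d \<in> \<Omega> \<and> dif a b \<boxplus> dif c d \<notin> difs"

text \<open>The sum is that of the four vectors \<open>fn a\<close>, \<open>fn b\<close>,
  \<open>fn c\<close>, \<open>fn d\<close> and hence symmetric in the points.\<close>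

lemma bad_perm:
  assumes "bad a b c d" shows "bad b a c d" "bad a c b d" "bad a b d c"
proof -
  have "dif a b \<boxplus> dif c d = dif b a \<boxplus> dif c d" "dif a b \<boxplus> dif c d = dif a c \<boxplus> dif b d"
    "dif a b \<boxplus> dif c d = dif a b \<boxplus> dif d c" by (auto simp: dif_def)
  then show "bad b a c d" "bad a c b d" "bad a b d c" using assms by (auto simp: bad_def)
qed

lemma bad_cover: "bad a b c d \<Longrightarrow> x \<in> \<Omega> \<Longrightarrow> ncol a b x \<or> ncol c d x"
  using difs_sum_collinear[of a b c d x] by (auto simp: bad_def)

lemma bad_ncol: 
  assumes "bad a b c d" shows "ncol a b c" "ncol a b d" "ncol a c d" "ncol b c d"
  using bad_cover[OF assms, of a] bad_cover[OF assms, of b] bad_cover[OF assms, of c]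
    bad_cover[OF assms, of d] assms ncol_swap(2)[of c d] ncol_swap(1)[of a c d] ncol_swap(1)[of b c d] by (auto simp: bad_def)

text \<open>The cocycle identity gives \<open>ncol c d z\<close>. If the new sum were a difference
  \<open>dif x y\<close>, it would take distinct values at \<open>z\<close> and \<open>d\<close>. By
  \<open>difs_sum_odd\<close> the old sum, which is \<open>dif x y + dif z d\<close>, would then be
  a difference too.\<close>

lemma bad_exchange:
  assumes "bad a b c d" "z \<in> \<Omega>" "ncol a b z" "ncol a c z" "ncol a d z"
  shows "bad a b c z"
proof (rule ccontr)
  assume "\<not> bad a b c z"
  then obtain x y where xy: "x \<in> \<Omega>" "y \<in> \<Omega>" "dif a b \<boxplus> dif c z = dif x y"
    using assms(1,2) by (auto simp: bad_def difs_def)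
  note p = assms(1)[unfolded bad_def] assms(2)
  have "ncol c d z"
    using ncol_cocycle[of a c d z] bad_ncol[OF assms(1)] assms p by auto
  then have "dif x y z \<noteq> dif x y d"
    using bad_ncol[OF assms(1)] assms(3) p dif_ncol[of a b z] dif_ncol[of a b d]
      dif_ncol[of c z d] dif_ncol[of c z z] ncol_swap(2)[of c z d]
    by (auto simp flip: xy(3))
  then have "dif x y \<boxplus> dif z d \<in> difs" using xy p difs_sum_odd by blast
  moreover have "dif x y \<boxplus> dif z d = dif a b \<boxplus> dif c d"
    unfolding xy(3)[symmetric] by (auto simp: dif_def)
  ultimately show False using assms(1) by (simp add: bad_def)
qed

text \<open>Since \<open>z\<close> may replace \<open>d\<close>, the point \<open>u\<close> cannot
  be collinear with both \<open>a b\<close> and \<open>c z\<close>. The cocycle identity on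
  \<open>a\<close>, \<open>c\<close>, \<open>z\<close>, \<open>u\<close> then decides the remaining
  triple.\<close>

lemma bad_exchange_collinear:
  assumes "bad a b c d" "z \<in> \<Omega>" "ncol a b z" "ncol a c z" "ncol a d z"
    and "u \<in> \<Omega>" "\<not> ncol a b u" "\<not> ncol a c u"
  shows "\<not> ncol a u z"
proof -
  have "bad a b c z" using bad_exchange assms by blast
  then have "ncol c z u" using bad_cover assms by blast
  then show ?thesis
    using ncol_cocycle[of a c z u] assms ncol_swap(2)[of a u z] by (auto simp: bad_def)
qed

lemma card_eq_sum_of_bool: "card {y\<in>\<Omega>. P y} = (\<Sum>y\<in>\<Omega>. of_bool (P y))"
  using fin by (simp add: Int_def conj_commute)

text \<open>A violation \<open>a\<close>, \<open>b\<close>, \<open>c\<close>, \<open>d\<close>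
  yields a point \<open>u\<close>, different from \<open>a\<close> and collinear with
  \<open>a b\<close>, \<open>a c\<close> and \<open>a d\<close>, and a point \<open>z\<close>
  collinear with none of these pairs. A pointwise inequality between collinearity indicators, summed
  over \<Omega>, then contradicts the constancy of the count \<open>S\<close>.\<close>

lemma difs_closed:
  assumes "v \<in> difs" "w \<in> difs" shows "v \<boxplus> w \<in> difs"
proof (rule ccontr)
  assume "v \<boxplus> w \<notin> difs"
  then obtain a b c d where bad: "bad a b c d"
    using assms by (auto simp: difs_def bad_def)
  then have pts: "a \<in> \<Omega>" "b \<in> \<Omega>" "c \<in> \<Omega>" "d \<in> \<Omega>" by (auto simp: bad_def)
  note N = bad_ncol[OF bad]
  have ne: "a \<noteq> b" "a \<noteq> c" "a \<noteq> d" "b \<noteq> c" "b \<noteq> d" "c \<noteq> d" using N by (auto simp: ncol_def)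
  obtain S :: nat where "S > 2"
    and S: "\<And>a b. a \<in> \<Omega> \<Longrightarrow> b \<in> \<Omega> \<Longrightarrow> a \<noteq> b \<Longrightarrow> (\<Sum>y\<in>\<Omega>. of_bool (\<not> ncol a b y)) = S"
    using collinear_count unfolding card_eq_sum_of_bool by blast
  have via_a: "ncol b c y = (ncol a b y = ncol a c y)" "ncol b d y = (ncol a b y = ncol a d y)"
    "ncol c d y = (ncol a c y = ncol a d y)" if "y \<in> \<Omega>" for y
    using ncol_cocycle[of a b c y] ncol_cocycle[of a b d y] ncol_cocycle[of a c d y] pts N that by auto
  \<comment> \<open>Together with \<open>via_a\<close> this says that never exactly two of the
    triples \<open>a b y\<close>, \<open>a c y\<close>, \<open>a d y\<close> are collinear.\<close>
  have cover: "ncol a b y \<or> ncol c d y" "ncol a c y \<or> ncol b d y" "ncol a d y \<or> ncol b c y"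
    if "y \<in> \<Omega>" for y
    using bad_cover[OF bad that] bad_cover[OF bad_perm(2)[OF bad] that]
      bad_cover[OF bad_perm(2)[OF bad_perm(3)[OF bad]] that] ncol_swap(1)[of b c y] by auto
  let ?A = "\<lambda>y. \<not> ncol a b y \<and> \<not> ncol a c y \<and> \<not> ncol a d y"
  let ?Z = "\<lambda>y. ncol a b y \<and> ncol a c y \<and> ncol a d y"
  \<comment> \<open>\<open>S\<close> points satisfy each of two conditions whose conjunction is \<open>?A\<close>, and \<open>S\<close> points
    satisfy exactly one, so \<open>?A\<close> holds for \<open>S/2 > 1\<close> points.\<close>
  obtain u where u: "u \<in> \<Omega>" "?A u" "u \<noteq> a"
  proof -
    have "(\<Sum>y\<in>\<Omega>. of_bool (\<not> ncol a b y) + of_bool (\<not> ncol a c y))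
        = (\<Sum>y\<in>\<Omega>. of_bool (\<not> ncol b c y) + 2 * of_bool (?A y) :: nat)"
      by (intro sum.cong refl) (use via_a cover in \<open>auto simp: of_bool_def\<close>)
    then have "2 * card {y\<in>\<Omega>. ?A y} = S"
      using pts ne S unfolding card_eq_sum_of_bool by (simp add: sum.distrib sum_distrib_left)
    then have "card {y\<in>\<Omega>. ?A y} > 1" using \<open>S > 2\<close> by linarith
    then have "\<not> {y\<in>\<Omega>. ?A y} \<subseteq> {a}"
      using card_mono[of "{a}" "{y\<in>\<Omega>. ?A y}"] by auto
    then show ?thesis using that by blast
  qed
  \<comment> \<open>Without such a point the conditions \<open>ncol a b y\<close> and
    \<open>ncol c d y\<close> would be complementary. The sum of the two differences would then be
    constant on \<Omega> and zero at \<open>base\<close>, hence the zero difference.\<close>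
  have "\<exists>z\<in>\<Omega>. ?Z z"
  proof (rule ccontr)
    assume no: "\<not> (\<exists>z\<in>\<Omega>. ?Z z)"
    have 1: "ncol a b y \<noteq> ncol c d y" if "y \<in> \<Omega>" for y
      using no via_a[OF that] cover[OF that] that by auto
    have "\<not> (dif a b \<boxplus> dif c d) y" for y
    proof (cases "y \<in> \<Omega>")
      case True
      then show ?thesis
        using 1[OF True] 1[OF base_in] dif_base[of a b] dif_base[of c d] pts base_in
          dif_ncol[of a b y] dif_ncol[of c d y] dif_ncol[of a b base] dif_ncol[of c d base]
        by auto
    qed (simp add: dif_outside)
    then have "dif a b \<boxplus> dif c d = dif a a" by (auto simp: dif_def)
    then show False using bad pts by (auto simp: bad_def difs_def)
  qed
  then obtain z where z: "z \<in> \<Omega>" "?Z z" by blast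
  \<comment> \<open>As \<open>z\<close> is noncollinear with all six pairs, each of the four points
    can take the role of \<open>a\<close> in the exchange argument.\<close>
  have zb: "ncol b a z" "ncol b c z" "ncol b d z" "ncol c a z" "ncol c b z" "ncol c d z"
     "ncol d a z" "ncol d b z" "ncol d c z"
    using via_a[OF z(1)] z(2) ncol_swap(1) by blast+
  have split_a: "\<not> ncol a y z" if "y \<in> \<Omega>" "?A y" for y
    using bad_exchange_collinear[OF bad] z that by blast
  have split_b: "\<not> ncol b y z" if "y \<in> \<Omega>" "\<not> ncol a b y" "ncol a c y" for y
    using bad_exchange_collinear[OF bad_perm(1)[OF bad], of z y] z zb that via_a[OF that(1)] ncol_swap(1)[of a b y]
    by auto
  have bad_c: "bad c a b d" using bad bad_perm by blast
  have split_c: "\<not> ncol c y z" if "y \<in> \<Omega>" "\<not> ncol a c y" "ncol a b y" for y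
    using bad_exchange_collinear[OF bad_c, of z y] z zb that via_a[OF that(1)] ncol_swap(1)[of a c y]
      ncol_swap(1)[of b c y] by auto
  have bad_d: "bad d a b c" using bad bad_perm by blast
  have split_d: "\<not> ncol d y z" if "y \<in> \<Omega>" "\<not> ncol a d y" "ncol a b y" for y
    using bad_exchange_collinear[OF bad_d, of z y] z zb that via_a[OF that(1)] ncol_swap(1)[of a d y]
      ncol_swap(1)[of b d y] by auto
  have auz: "\<not> ncol a u z" using split_a u by blast
  have "u \<noteq> z" "u \<noteq> b" "u \<noteq> c" "u \<noteq> d" "a \<noteq> z" using u z N ncol_swap(2)[of a b c] by auto
  \<comment> \<open>Summed over all points, both sides count multiples of the constant \<open>S\<close>: six on the left, five on
    the right.\<close>
  have pointwise: "(of_bool (\<not> ncol b c y) + 2 * of_bool (\<not> ncol a z y) + of_bool (\<not> ncol u b y)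
      + of_bool (\<not> ncol u c y) + of_bool (\<not> ncol u d y) :: nat)
    \<le> of_bool (\<not> ncol a u y) + 2 * of_bool (\<not> ncol u z y) + of_bool (\<not> ncol a b y)
      + of_bool (\<not> ncol a c y)" if y: "y \<in> \<Omega>" for y
  proof -
    \<comment> \<open>The cocycle identity at \<open>a\<close> expresses all indicators by the five
      bits on which the final case split runs.\<close>
    have 1: "ncol u b y = (ncol a b y \<noteq> ncol a u y)" "ncol u c y = (ncol a c y \<noteq> ncol a u y)"
      "ncol u d y = (ncol a d y \<noteq> ncol a u y)" "ncol u z y = (ncol a z y \<noteq> ncol a u y)"
      using ncol_cocycle[of a u b y] ncol_cocycle[of a u c y] ncol_cocycle[of a u d y]
        ncol_cocycle[of a u z y] pts u z y auz ncol_swap(2)[of a u]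
      by auto
    have 2: "ncol b y z = (\<not> ncol a y z \<noteq> ncol a b y)" "ncol c y z = (\<not> ncol a y z \<noteq> ncol a c y)"
      "ncol d y z = (\<not> ncol a y z \<noteq> ncol a d y)"
      using ncol_cocycle[of a b y z] ncol_cocycle[of a c y z] ncol_cocycle[of a d y z] pts z y by auto
    have sw: "ncol a z y = ncol a y z" by (rule ncol_swap(2))
    \<comment> \<open>Here \<open>y\<close> itself plays the role of \<open>z\<close>.\<close>
    have 3: "?Z y \<Longrightarrow> \<not> ncol a u y"
      using bad_exchange_collinear[OF bad y] u by blast
    show ?thesis
      using split_a[OF y] split_b[OF y] split_c[OF y] split_d[OF y] 3 via_a[OF y] cover[OF y]
      unfolding 1 2 sw
      by (cases "ncol a b y"; cases "ncol a c y"; cases "ncol a d y"; cases "ncol a u y";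
          cases "ncol a y z"; simp)
  qed
  have "(\<Sum>y\<in>\<Omega>. of_bool (\<not> ncol b c y) + 2 * of_bool (\<not> ncol a z y) + of_bool (\<not> ncol u b y)
      + of_bool (\<not> ncol u c y) + of_bool (\<not> ncol u d y))
    \<le> (\<Sum>y\<in>\<Omega>. of_bool (\<not> ncol a u y) + 2 * of_bool (\<not> ncol u z y) + of_bool (\<not> ncol a b y)
      + of_bool (\<not> ncol a c y) :: nat)"
    by (intro sum_mono pointwise)
  then have "6 * S \<le> 5 * S"
    using pts u z ne \<open>u \<noteq> z\<close> \<open>u \<noteq> b\<close> \<open>u \<noteq> c\<close> \<open>u \<noteq> d\<close> \<open>a \<noteq> z\<close>
    by (simp add: sum.distrib S flip: sum_distrib_left)
  then show False using \<open>S > 2\<close> by simp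
qed

text \<open>A zero difference makes every point collinear with \<open>a\<close> and
  \<open>b\<close>. Then \<open>S\<close> is \<open>card \<Omega>\<close>, and all triples would be
  collinear. This gives the injectivity of the coordinates.\<close>

lemma difs_nonzero:
  assumes "ncol p q r" "p \<in> \<Omega>" "q \<in> \<Omega>" "r \<in> \<Omega>" "a \<in> \<Omega>" "b \<in> \<Omega>" "a \<noteq> b"
  shows "dif a b \<noteq> (\<lambda>_. False)"
proof
  assume 0: "dif a b = (\<lambda>_. False)"
  obtain S where
    S: "\<And>a b. a \<in> \<Omega> \<Longrightarrow> b \<in> \<Omega> \<Longrightarrow> a \<noteq> b \<Longrightarrow> card {y\<in>\<Omega>. \<not> ncol a b y} = S"
    using collinear_count by blast
  have "{y\<in>\<Omega>. \<not> ncol a b y} = \<Omega>"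
    using dif_ncol[OF assms(5,6)] 0 by auto
  then have "S = card \<Omega>" using S[OF assms(5-7)] by simp
  moreover have "p \<noteq> q" using assms(1) by auto
  ultimately have "card {y\<in>\<Omega>. \<not> ncol p q y} = card \<Omega>" using S[OF assms(2,3)] by simp
  then have "{y\<in>\<Omega>. \<not> ncol p q y} = \<Omega>"
    using fin by (intro card_subset_eq) auto
  then show False using assms by blast
qed

end

section \<open>Moves as affine transvections\<close>

text \<open>A common setting for both cases: \<iota> assigns coordinates to the points, and \<phi>
  is zero if all triples are collinear and the standard symplectic form otherwise.\<close>

locale design_rep =
  fixes \<Omega> :: "'a set" and B :: "'a set set" and base :: 'a
    and \<iota> :: "'a \<Rightarrow> nat \<Rightarrow> bool" and \<phi> :: "(nat \<Rightarrow> bool) \<Rightarrow> (nat \<Rightarrow> bool) \<Rightarrow> bool"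
  assumes base_in: "base \<in> \<Omega>"
    and \<iota>_inj: "inj_on \<iota> \<Omega>"
    and \<phi>_add: "\<phi> (u \<boxplus> v) w \<longleftrightarrow> \<phi> u w \<noteq> \<phi> v w"
    and \<phi>_sym: "\<phi> v w \<longleftrightarrow> \<phi> w v"
    and \<phi>_alt: "\<not> \<phi> v v"
    and move_in: "a \<in> \<Omega> \<Longrightarrow> b \<in> \<Omega> \<Longrightarrow> x \<in> \<Omega> \<Longrightarrow> elem_move B a b x \<in> \<Omega>"
    and move_outside: "a \<in> \<Omega> \<Longrightarrow> b \<in> \<Omega> \<Longrightarrow> x \<notin> \<Omega> \<Longrightarrow> elem_move B a b x = x"
    and \<iota>_move: "a \<in> \<Omega> \<Longrightarrow> b \<in> \<Omega> \<Longrightarrow> x \<in> \<Omega> \<Longrightarrow>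
      \<iota> (elem_move B a b x) = \<iota> x \<boxplus> scale2 (\<not> \<phi> (\<iota> a \<boxplus> \<iota> b) (\<iota> a \<boxplus> \<iota> x)) (\<iota> a \<boxplus> \<iota> b)"
begin

lemma \<phi>_add_right: "\<phi> w (u \<boxplus> v) \<longleftrightarrow> \<phi> w u \<noteq> \<phi> w v"
  using \<phi>_add \<phi>_sym by metis

lemma \<phi>_zero: "\<not> \<phi> (\<lambda>_. False) v" "\<not> \<phi> v (\<lambda>_. False)"
  using \<phi>_add[of v v v] \<phi>_add_right[of v v v] by auto

lemma \<phi>_scale: "\<phi> (scale2 b u) v \<longleftrightarrow> b \<and> \<phi> u v" "\<phi> v (scale2 b u) \<longleftrightarrow> b \<and> \<phi> v u"
  by (cases b; simp add: \<phi>_zero)+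

lemmas \<phi>_rules = \<phi>_add \<phi>_add_right \<phi>_zero \<phi>_scale \<phi>_alt

lemma \<iota>_eqI: "\<iota> x = \<iota> y \<Longrightarrow> x \<in> \<Omega> \<Longrightarrow> y \<in> \<Omega> \<Longrightarrow> x = y"
  using \<iota>_inj by (rule inj_onD)

lemma move_self [simp]: "elem_move B a a = id"
  by (auto simp: elem_move_def)

lemma move_ends [simp]: "elem_move B a b a = b" "elem_move B a b b = a"
  by (auto simp: elem_move_def)

lemma move_eqI:
  assumes "a \<in> \<Omega>" "b \<in> \<Omega>" "c \<in> \<Omega>" "d \<in> \<Omega>"
    and "\<And>x. x \<in> \<Omega> \<Longrightarrow> \<iota> (elem_move B a b x) = \<iota> (elem_move B c d x)"
  shows "elem_move B a b = elem_move B c d"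
proof
  fix x show "elem_move B a b x = elem_move B c d x"
    using assms move_in move_outside \<iota>_eqI by (cases "x \<in> \<Omega>") auto
qed

lemma move_sym:
  assumes "a \<in> \<Omega>" "b \<in> \<Omega>" shows "elem_move B a b = elem_move B b a"
  using assms by (intro move_eqI) (auto simp: \<iota>_move \<phi>_rules xadd_comm[of "\<iota> b"] fun_eq_iff \<phi>_sym[of "\<iota> b" "\<iota> a"])

lemma move_invol:
  assumes "a \<in> \<Omega>" "b \<in> \<Omega>" shows "elem_move B a b (elem_move B a b x) = x"
proof (cases "x \<in> \<Omega>")
  case True
  then show ?thesis
    using assms by (intro \<iota>_eqI) (auto simp: \<iota>_move move_in \<phi>_rules fun_eq_iff)
qed (use assms move_outside in simp)

lemma move_invol_comp:
  assumes "a \<in> \<Omega>" "b \<in> \<Omega>" shows "elem_move B a b \<circ> elem_move B a b = id"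
  using move_invol[OF assms] by auto

text \<open>A moved point \<open>x\<close> and its image differ by
  \<open>\<iota> a + \<iota> b\<close>. As this vector is orthogonal to
  \<open>\<iota> a + \<iota> x\<close>, the two moves also shift the same points.\<close>

lemma move_through:
  assumes "a \<in> \<Omega>" "b \<in> \<Omega>" "x \<in> \<Omega>" "elem_move B a b x \<noteq> x"
  shows "elem_move B a b = elem_move B x (elem_move B a b x)"
proof (rule move_eqI)
  let ?y = "elem_move B a b x"
  have y: "?y \<in> \<Omega>" using assms move_in by blast
  have n: "\<not> \<phi> (\<iota> a \<boxplus> \<iota> b) (\<iota> a \<boxplus> \<iota> x)"
    using assms \<iota>_move[OF assms(1-3)] \<iota>_eqI[OF _ y assms(3)] by auto
  then have e: "\<iota> x \<boxplus> \<iota> ?y = \<iota> a \<boxplus> \<iota> b" using \<iota>_move[OF assms(1-3)] by auto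
  show "\<iota> (elem_move B a b t) = \<iota> (elem_move B x ?y t)" if t: "t \<in> \<Omega>" for t
  proof -
    have "\<phi> (\<iota> a \<boxplus> \<iota> b) (\<iota> x \<boxplus> \<iota> t) = \<phi> (\<iota> a \<boxplus> \<iota> b) (\<iota> a \<boxplus> \<iota> t)"
      using n unfolding \<phi>_add_right by blast
    then show ?thesis using assms t y by (simp add: \<iota>_move[of a b t] \<iota>_move[of x ?y t] e)
  qed
qed (use assms move_in in auto)

text \<open>A relation between \<open>g\<close> and its linear part, since \<open>g\<close>
  determines \<tau> only on differences of points.\<close>

definition affine :: "('a \<Rightarrow> 'a) \<Rightarrow> ((nat \<Rightarrow> bool) \<Rightarrow> nat \<Rightarrow> bool) \<Rightarrow> bool" where
  "affine g \<tau> \<longleftrightarrow> (\<forall>x\<in>\<Omega>. g x \<in> \<Omega>) \<and> (\<forall>x. x \<notin> \<Omega> \<longrightarrow> g x = x)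
    \<and> (\<forall>x\<in>\<Omega>. \<forall>y\<in>\<Omega>. \<iota> (g x) \<boxplus> \<iota> (g y) = \<tau> (\<iota> x \<boxplus> \<iota> y))"

lemma affineD:
  assumes "affine g \<tau>"
  shows "x \<in> \<Omega> \<Longrightarrow> g x \<in> \<Omega>" "x \<notin> \<Omega> \<Longrightarrow> g x = x"
    "x \<in> \<Omega> \<Longrightarrow> y \<in> \<Omega> \<Longrightarrow> \<iota> (g x) \<boxplus> \<iota> (g y) = \<tau> (\<iota> x \<boxplus> \<iota> y)"
  using assms by (auto simp: affine_def)

lemma affine_id: "affine id id"
  by (simp add: affine_def)

lemma affine_comp: "affine g \<sigma> \<Longrightarrow> affine h \<tau> \<Longrightarrow> affine (h \<circ> g) (\<tau> \<circ> \<sigma>)"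
  by (simp add: affine_def)

lemma affine_move:
  assumes "a \<in> \<Omega>" "b \<in> \<Omega>"
  shows "affine (elem_move B a b) (\<lambda>v. v \<boxplus> scale2 (\<phi> (\<iota> a \<boxplus> \<iota> b) v) (\<iota> a \<boxplus> \<iota> b))"
  using assms by (auto simp: affine_def move_in move_outside \<iota>_move \<phi>_add_right fun_eq_iff)

definition isometry :: "((nat \<Rightarrow> bool) \<Rightarrow> nat \<Rightarrow> bool) \<Rightarrow> bool" where
  "isometry \<tau> \<longleftrightarrow> (\<forall>u v. \<tau> (u \<boxplus> v) = \<tau> u \<boxplus> \<tau> v) \<and> (\<forall>u v. \<phi> (\<tau> u) (\<tau> v) = \<phi> u v)"

lemma isometry_transvection: "isometry (\<lambda>v. v \<boxplus> scale2 (\<phi> e v) e)"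
  unfolding isometry_def
proof (intro conjI allI)
  fix u v
  show "u \<boxplus> v \<boxplus> scale2 (\<phi> e (u \<boxplus> v)) e = u \<boxplus> scale2 (\<phi> e u) e \<boxplus> (v \<boxplus> scale2 (\<phi> e v) e)"
    by (auto simp: \<phi>_add_right fun_eq_iff)
  show "\<phi> (u \<boxplus> scale2 (\<phi> e u) e) (v \<boxplus> scale2 (\<phi> e v) e) = \<phi> u v"
    using \<phi>_sym[of u e] by (auto simp: \<phi>_rules)
qed

lemma isometry_comp: "isometry \<sigma> \<Longrightarrow> isometry \<tau> \<Longrightarrow> isometry (\<tau> \<circ> \<sigma>)"
  unfolding isometry_def by (metis comp_apply)

text \<open>The linear part preserves \<phi>, so \<open>x\<close> is shifted by
  \<open>[a, b]\<close> exactly if \<open>g x\<close> is shifted by \<open>[g a, g b]\<close>, and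
  the shift vectors correspond under \<tau>.\<close>

lemma affine_conj:
  assumes "affine g \<tau>" "isometry \<tau>" "a \<in> \<Omega>" "b \<in> \<Omega>"
  shows "g \<circ> elem_move B a b = elem_move B (g a) (g b) \<circ> g"
proof
  fix x
  note g = affineD[OF assms(1)]
  show "(g \<circ> elem_move B a b) x = (elem_move B (g a) (g b) \<circ> g) x"
  proof (cases "x \<in> \<Omega>")
    case True
    let ?y = "elem_move B a b x"
    let ?c = "\<not> \<phi> (\<iota> a \<boxplus> \<iota> b) (\<iota> a \<boxplus> \<iota> x)"
    have y: "?y \<in> \<Omega>" using True assms move_in by blast
    have "\<phi> (\<iota> (g a) \<boxplus> \<iota> (g b)) (\<iota> (g a) \<boxplus> \<iota> (g x)) = \<phi> (\<iota> a \<boxplus> \<iota> b) (\<iota> a \<boxplus> \<iota> x)"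
      unfolding g(3)[OF assms(3,4)] g(3)[OF assms(3) True] using assms(2) unfolding isometry_def by blast
    then have 1: "\<iota> (elem_move B (g a) (g b) (g x)) = \<iota> (g x) \<boxplus> scale2 ?c (\<tau> (\<iota> a \<boxplus> \<iota> b))"
      using \<iota>_move[OF g(1)[OF assms(3)] g(1)[OF assms(4)] g(1)[OF True]] g(3)[OF assms(3,4)]
      by (simp only:)
    have "\<iota> x \<boxplus> \<iota> ?y = scale2 ?c (\<iota> a \<boxplus> \<iota> b)" using \<iota>_move[OF assms(3,4) True] by auto
    then have "\<iota> (g x) \<boxplus> \<iota> (g ?y) = \<tau> (scale2 ?c (\<iota> a \<boxplus> \<iota> b))" using g(3)[OF True y] by simp
    also have "\<dots> = scale2 ?c (\<tau> (\<iota> a \<boxplus> \<iota> b))"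
    proof (cases ?c)
      case False
      have "\<tau> ((\<lambda>_. False) \<boxplus> (\<lambda>_. False)) = \<tau> (\<lambda>_. False) \<boxplus> \<tau> (\<lambda>_. False)"
        using assms(2) unfolding isometry_def by blast
      then show ?thesis using False by simp
    qed simp
    finally have "\<iota> (g ?y) = \<iota> (g x) \<boxplus> scale2 ?c (\<tau> (\<iota> a \<boxplus> \<iota> b))" by (metis xadd_left_cancel)
    then show ?thesis using 1 g assms True y move_in by (auto intro!: \<iota>_eqI)
  next
    case False
    then show ?thesis using g assms move_outside by simp
  qed
qed

section \<open>The group of move sequences\<close>

lemma move_seq_affine:
  assumes "set xs \<subseteq> \<Omega>" shows "\<exists>\<tau>. affine (move_seq B xs) \<tau> \<and> isometry \<tau>"
  using assms
proof (induction xs rule: induct_list012)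
  case (3 a b rest)
  then obtain \<tau> where \<tau>: "affine (move_seq B (b # rest)) \<tau>" "isometry \<tau>" by auto
  let ?e = "\<iota> a \<boxplus> \<iota> b"
  have "affine (move_seq B (a # b # rest)) (\<tau> \<circ> (\<lambda>v. v \<boxplus> scale2 (\<phi> ?e v) ?e))"
    using affine_comp[OF affine_move \<tau>(1), of a b] 3(3) by simp
  moreover have "isometry (\<tau> \<circ> (\<lambda>v. v \<boxplus> scale2 (\<phi> ?e v) ?e))"
    using isometry_comp[OF isometry_transvection \<tau>(2)] .
  ultimately show ?case by blast
qed (auto intro!: exI[of _ id] affine_id simp: isometry_def)

lemma move_seq_append: "move_seq B (xs @ a # ys) = move_seq B (a # ys) \<circ> move_seq B (xs @ [a])"
  by (induction xs rule: induct_list012) (auto simp: comp_assoc)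

lemma L_infE:
  assumes "g \<in> L_inf \<Omega> B base"
  obtains xs where "g = move_seq B xs" "set xs \<subseteq> \<Omega>"
  using assms base_in unfolding L_inf_def by (auto intro!: that)

lemma id_L_inf: "id \<in> L_inf \<Omega> B base"
  unfolding L_inf_def using base_in by (intro CollectI exI[of _ "[base]"]) simp

text \<open>If \<open>a\<close> is fixed by \<open>[c, d]\<close>, then \<open>[c, d] = [a, c, d, a]\<close>; otherwise
  \<open>[c, d] = [a, b]\<close> with \<open>b\<close> the image of \<open>a\<close>.\<close>
lemma move_from_point:
  assumes "a \<in> \<Omega>" "c \<in> \<Omega>" "d \<in> \<Omega>"
  shows "\<exists>ys. set ys \<subseteq> \<Omega> \<and> elem_move B c d = move_seq B (a # ys)"
proof (cases "elem_move B c d a = a")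
  case True
  \<comment> \<open>Since \<open>[c, d]\<close> fixes \<open>a\<close> and takes \<open>c\<close> to
    \<open>d\<close>, it conjugates \<open>[a, c]\<close> to \<open>[a, d]\<close>.\<close>
  have "elem_move B c d \<circ> elem_move B a c = elem_move B a d \<circ> elem_move B c d"
    using affine_conj[OF affine_move isometry_transvection, of c d a c] assms True by simp
  then have "elem_move B d a \<circ> (elem_move B c d \<circ> elem_move B a c)
      = elem_move B a d \<circ> elem_move B a d \<circ> elem_move B c d"
    using move_sym assms by (simp add: comp_assoc)
  then have "elem_move B c d = move_seq B [a, c, d, a]"
    using move_invol_comp assms by (simp add: comp_assoc)
  then show ?thesis using assms by (intro exI[of _ "[c, d, a]"]) simp
next
  case False
  then have "elem_move B c d = move_seq B [a, elem_move B c d a]"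
    using move_through assms by simp
  then show ?thesis using assms move_in by (intro exI[of _ "[elem_move B c d a]"]) simp
qed

text \<open>The sequence is continued from its last point, from which \<open>[c, d]\<close> can be
  written as a move sequence. Closure of \<open>L_inf\<close> under products rests on this.\<close>

lemma move_comp_L_inf:
  assumes "g \<in> L_inf \<Omega> B base" "c \<in> \<Omega>" "d \<in> \<Omega>"
  shows "elem_move B c d \<circ> g \<in> L_inf \<Omega> B base"
proof -
  obtain as where as: "g = move_seq B (base # as)" "as \<noteq> []" "set as \<subseteq> \<Omega>"
    using assms(1) by (auto simp: L_inf_def)
  then have "last as \<in> \<Omega>" using last_in_set by blast
  then obtain ys where ys: "set ys \<subseteq> \<Omega>" "elem_move B c d = move_seq B (last as # ys)"
    using move_from_point assms by blast
  have "move_seq B ((base # butlast as) @ last as # ys)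
      = elem_move B c d \<circ> move_seq B ((base # butlast as) @ [last as])"
    unfolding ys(2) by (rule move_seq_append)
  then have "elem_move B c d \<circ> g = move_seq B (base # (butlast as @ last as # ys))"
    using as by simp
  moreover have "set (butlast as @ last as # ys) \<subseteq> \<Omega>"
    using as ys \<open>last as \<in> \<Omega>\<close> in_set_butlastD by fastforce
  ultimately show ?thesis unfolding L_inf_def by blast
qed

lemma move_L_inf: "c \<in> \<Omega> \<Longrightarrow> d \<in> \<Omega> \<Longrightarrow> elem_move B c d \<in> L_inf \<Omega> B base"
  using move_comp_L_inf[OF id_L_inf] by simp

lemma move_seq_comp_L_inf:
  assumes "g \<in> L_inf \<Omega> B base" "set xs \<subseteq> \<Omega>"
  shows "move_seq B xs \<circ> g \<in> L_inf \<Omega> B base"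
  using assms
proof (induction xs arbitrary: g rule: induct_list012)
  case (3 a b rest)
  then have "move_seq B (b # rest) \<circ> (elem_move B a b \<circ> g) \<in> L_inf \<Omega> B base"
    using move_comp_L_inf[of g a b] by (intro "3.IH"(2)) (auto simp: comp_def)
  then show ?case by (simp only: move_seq.simps comp_assoc)
qed auto

lemma move_seq_inverse:
  assumes "set xs \<subseteq> \<Omega>"
  shows "\<exists>h\<in>L_inf \<Omega> B base. move_seq B xs \<circ> h = id"
  using assms
proof (induction xs rule: induct_list012)
  case (3 a b rest)
  then obtain h where h: "h \<in> L_inf \<Omega> B base" "move_seq B (b # rest) \<circ> h = id"
    using 3 by (metis insert_subset list.simps(15))
  have "move_seq B (a # b # rest) \<circ> (elem_move B a b \<circ> h)
      = move_seq B (b # rest) \<circ> (elem_move B a b \<circ> elem_move B a b) \<circ> h"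
    by (simp add: comp_assoc)
  also have "\<dots> = id" using move_invol_comp 3(3) h(2) by simp
  finally show ?case
    by (rule bexI[of _ "elem_move B a b \<circ> h"]) (use move_comp_L_inf[OF h(1), of a b] 3(3) in auto)
qed (use id_L_inf in auto)

abbreviation "G \<equiv> L_group \<Omega> B base"

lemma G_simps [simp]: "carrier G = L_inf \<Omega> B base" "g \<otimes>\<^bsub>G\<^esub> h = h \<circ> g" "\<one>\<^bsub>G\<^esub> = id"
  by (simp_all add: L_group_def)

lemma group_G: "group G"
proof (rule groupI)
  fix x y assume "x \<in> carrier G" "y \<in> carrier G"
  then show "x \<otimes>\<^bsub>G\<^esub> y \<in> carrier G" using move_seq_comp_L_inf L_infE by (metis G_simps(1,2))
next
  fix x assume "x \<in> carrier G"
  then show "\<exists>y\<in>carrier G. y \<otimes>\<^bsub>G\<^esub> x = \<one>\<^bsub>G\<^esub>"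
    using move_seq_inverse L_infE by (metis G_simps)
qed (auto simp: id_L_inf comp_assoc)

lemma generate_moves: "generate G (elem_moves \<Omega> B) = carrier G"
proof
  have "elem_moves \<Omega> B \<subseteq> carrier G" using move_L_inf by (auto simp: elem_moves_def)
  then show "generate G (elem_moves \<Omega> B) \<subseteq> carrier G" by (rule group.generate_incl[OF group_G])
  have "move_seq B xs \<in> generate G (elem_moves \<Omega> B)" if "set xs \<subseteq> \<Omega>" for xs
    using that
  proof (induction xs rule: induct_list012)
    case 1
    then show ?case using generate.one[of G] by (simp only: G_simps move_seq.simps)
  next
    case (2 x)
    then show ?case using generate.one[of G] by (simp only: G_simps move_seq.simps)
  next
    case (3 a b rest)
    have "elem_move B a b \<in> generate G (elem_moves \<Omega> B)"
    proof (cases "a = b")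
      case True
      then show ?thesis using generate.one[of G] by (simp only: G_simps move_self)
    next
      case False
      then show ?thesis using 3(3) by (intro generate.incl) (auto simp: elem_moves_def)
    qed
    then have "elem_move B a b \<otimes>\<^bsub>G\<^esub> move_seq B (b # rest) \<in> generate G (elem_moves \<Omega> B)"
      using 3 by (intro generate.eng) auto
    then show ?case by (simp only: G_simps move_seq.simps)
  qed
  then show "carrier G \<subseteq> generate G (elem_moves \<Omega> B)"
    by (auto elim!: L_infE)
qed

lemma L_inf_affine: "g \<in> L_inf \<Omega> B base \<Longrightarrow> \<exists>\<tau>. affine g \<tau> \<and> isometry \<tau>"
  by (auto elim!: L_infE simp: move_seq_affine)

lemma L_inf_inj:
  assumes "g \<in> L_inf \<Omega> B base" shows "inj g"
proof -
  obtain h where "h \<in> carrier G" "g \<otimes>\<^bsub>G\<^esub> h = \<one>\<^bsub>G\<^esub>"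
    using assms group.r_inv_ex[OF group_G, of g] by auto
  then have "inj (h \<circ> g)" by simp
  then show ?thesis by (rule inj_on_imageI2)
qed

section \<open>The 3-transposition property\<close>

lemma move_conj_closed:
  assumes "g \<in> carrier G" "e \<in> elem_moves \<Omega> B"
  shows "inv\<^bsub>G\<^esub> g \<otimes>\<^bsub>G\<^esub> e \<otimes>\<^bsub>G\<^esub> g \<in> elem_moves \<Omega> B"
proof -
  interpret group G by (rule group_G)
  obtain a b where ab: "e = elem_move B a b" "a \<in> \<Omega>" "b \<in> \<Omega>" "a \<noteq> b"
    using assms(2) by (auto simp: elem_moves_def)
  obtain \<tau> where \<tau>: "affine g \<tau>" "isometry \<tau>" using assms(1) L_inf_affine by auto
  let ?f = "elem_move B (g a) (g b)"
  have gab: "g a \<in> \<Omega>" "g b \<in> \<Omega>" "g a \<noteq> g b"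
    using affineD(1)[OF \<tau>(1)] ab L_inf_inj assms(1) by (auto dest: injD)
  have "e \<otimes>\<^bsub>G\<^esub> g = g \<otimes>\<^bsub>G\<^esub> ?f" using affine_conj[OF \<tau> ab(2,3)] ab(1) by simp
  moreover have e: "e \<in> carrier G" and f: "?f \<in> carrier G" using ab gab move_L_inf by auto
  moreover have "inv\<^bsub>G\<^esub> g \<otimes>\<^bsub>G\<^esub> e \<otimes>\<^bsub>G\<^esub> g = inv\<^bsub>G\<^esub> g \<otimes>\<^bsub>G\<^esub> (e \<otimes>\<^bsub>G\<^esub> g)"
    by (rule m_assoc[OF inv_closed[OF assms(1)] e assms(1)])
  moreover have "inv\<^bsub>G\<^esub> g \<otimes>\<^bsub>G\<^esub> (g \<otimes>\<^bsub>G\<^esub> ?f) = ?f"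
    by (rule inv_solve_left'[THEN iffD2]) (use assms(1) f in \<open>auto simp del: G_simps\<close>)
  ultimately have "inv\<^bsub>G\<^esub> g \<otimes>\<^bsub>G\<^esub> e \<otimes>\<^bsub>G\<^esub> g = ?f" by (simp only:)
  then show ?thesis using gab by (auto simp: elem_moves_def)
qed

text \<open>Moves with orthogonal difference vectors commute, so their product squares to the
  identity. Otherwise the product has trivial cube.\<close>

lemma move_prod_cases:
  assumes "a \<in> \<Omega>" "b \<in> \<Omega>" "c \<in> \<Omega>" "d \<in> \<Omega>"
  defines "p \<equiv> elem_move B c d \<circ> elem_move B a b"
  shows "p \<circ> p = id \<or> p \<circ> (p \<circ> p) = id"
proof -
  let ?e = "\<iota> a \<boxplus> \<iota> b" and ?f = "\<iota> c \<boxplus> \<iota> d"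
  let ?M = "elem_move B a b" and ?N = "elem_move B c d"
  let ?\<alpha> = "\<lambda>x. \<not> \<phi> ?e (\<iota> a \<boxplus> \<iota> x)" and ?\<beta> = "\<lambda>x. \<not> \<phi> ?f (\<iota> c \<boxplus> \<iota> x)"
  define e f \<alpha> \<beta> where "e = ?e" and "f = ?f" and "\<alpha> = ?\<alpha>" and "\<beta> = ?\<beta>"
  have M: "?M x \<in> \<Omega>" "\<iota> (?M x) = \<iota> x \<boxplus> scale2 (\<alpha> x) e" if "x \<in> \<Omega>" for x
    using that assms move_in \<iota>_move by (auto simp: \<alpha>_def e_def)
  have N: "?N x \<in> \<Omega>" "\<iota> (?N x) = \<iota> x \<boxplus> scale2 (\<beta> x) f" if "x \<in> \<Omega>" for x
    using that assms move_in \<iota>_move by (auto simp: \<beta>_def f_def)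
  have ef: "\<phi> f e = \<phi> e f" by (rule \<phi>_sym)
  \<comment> \<open>The bits \<alpha> and \<beta> tell whether the first and the second move shift
    \<open>x\<close>. Their evolution under the moves determines the powers of the product.\<close>
  have \<alpha>: "\<alpha> (?M x) = \<alpha> x" "\<alpha> (?N x) = (\<alpha> x \<noteq> (\<beta> x \<and> \<phi> e f))" if "x \<in> \<Omega>" for x
    using M(2)[OF that] N(2)[OF that] unfolding \<alpha>_def e_def[symmetric] by (auto simp: \<phi>_rules)
  have \<beta>: "\<beta> (?N x) = \<beta> x" "\<beta> (?M x) = (\<beta> x \<noteq> (\<alpha> x \<and> \<phi> e f))" if "x \<in> \<Omega>" for x
    using M(2)[OF that] N(2)[OF that] ef unfolding \<beta>_def f_def[symmetric] by (auto simp: \<phi>_rules)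
  have outside: "?M x = x" "?N x = x" if "x \<notin> \<Omega>" for x using that assms move_outside by auto
  show ?thesis
  proof (cases "\<phi> e f")
    case False
    have "p (p x) = x" for x
    proof (cases "x \<in> \<Omega>")
      case True
      then have "\<iota> (p (p x)) = \<iota> x"
        using False by (auto simp: p_def M N \<alpha> \<beta> fun_eq_iff)
      then show ?thesis using True M N by (intro \<iota>_eqI) (auto simp: p_def)
    qed (simp add: p_def outside)
    then show ?thesis by auto
  next
    case t: True
    have "p (p (p x)) = x" for x
    proof (cases "x \<in> \<Omega>")
      case True
      then have "\<iota> (p (p (p x))) = \<iota> x"
        using t by (auto simp: p_def M N \<alpha> \<beta> fun_eq_iff)
      then show ?thesis using True M N by (intro \<iota>_eqI) (auto simp: p_def)
    qed (simp add: p_def outside)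
    then show ?thesis by auto
  qed
qed

theorem three_transposition: "three_transposition_group G (elem_moves \<Omega> B)"
  unfolding three_transposition_group_def
proof (intro conjI ballI)
  interpret group G by (rule group_G)
  show "group G" by (rule group_G)
  show "elem_moves \<Omega> B \<subseteq> carrier G" using move_L_inf by (auto simp: elem_moves_def)
  show "e \<otimes>\<^bsub>G\<^esub> e = \<one>\<^bsub>G\<^esub>" if "e \<in> elem_moves \<Omega> B" for e
    using that move_invol_comp by (auto simp: elem_moves_def)
  show "e \<noteq> \<one>\<^bsub>G\<^esub>" if e: "e \<in> elem_moves \<Omega> B" for e
  proof -
    obtain a b where "e = elem_move B a b" "a \<noteq> b" using e by (auto simp: elem_moves_def)
    then have "e a \<noteq> a" by simp
    then show ?thesis by auto
  qed
  show "generate G (elem_moves \<Omega> B) = carrier G" by (rule generate_moves)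
  show "inv\<^bsub>G\<^esub> g \<otimes>\<^bsub>G\<^esub> e \<otimes>\<^bsub>G\<^esub> g \<in> elem_moves \<Omega> B"
    if "g \<in> carrier G" "e \<in> elem_moves \<Omega> B" for g e
    using that by (rule move_conj_closed)
  show "group.ord G (g \<otimes>\<^bsub>G\<^esub> h) \<in> {1, 2, 3}"
    if gh: "g \<in> elem_moves \<Omega> B" "h \<in> elem_moves \<Omega> B" for g h
  proof -
    let ?p = "g \<otimes>\<^bsub>G\<^esub> h"
    have p: "?p \<in> carrier G"
      using gh move_L_inf by (intro m_closed) (auto simp: elem_moves_def)
    have "?p \<circ> ?p = id \<or> ?p \<circ> (?p \<circ> ?p) = id"
      using gh move_prod_cases by (auto simp: elem_moves_def)
    then have "?p [^]\<^bsub>G\<^esub> (2::nat) = \<one>\<^bsub>G\<^esub> \<or> ?p [^]\<^bsub>G\<^esub> (3::nat) = \<one>\<^bsub>G\<^esub>"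
      by (simp add: numeral_2_eq_2 numeral_3_eq_3 nat_pow_Suc)
    then have "ord ?p dvd 2 \<or> ord ?p dvd 3" using pow_eq_id[OF p] by blast
    then show ?thesis
    proof
      assume "ord ?p dvd 2"
      then have "ord ?p \<in> {1, 2}" using two_is_prime_nat prime_nat_iff by blast
      then show ?thesis by blast
    next
      assume d: "ord ?p dvd 3"
      then have "ord ?p \<le> 3" by (rule dvd_imp_le) simp
      moreover have "ord ?p \<noteq> 0" using d by (metis dvd_0_left_iff zero_neq_numeral)
      ultimately show ?thesis by auto
    qed
  qed
qed

end

section \<open>Linear parts and periods\<close>

context design_rep begin

definition transl :: "('a \<Rightarrow> 'a) set" where
  "transl = {g \<in> L_inf \<Omega> B base. affine g id}"

text \<open>A translation is determined by the image of \<open>base\<close>, whose coordinate vector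
  is the origin.\<close>

lemma transl_iso:
  assumes zero: "\<iota> base = (\<lambda>_. False)" and in_V: "\<And>a. a \<in> \<Omega> \<Longrightarrow> \<iota> a \<in> F2vec k"
    and surj: "\<And>v. v \<in> F2vec k \<Longrightarrow> \<exists>g\<in>transl. \<iota> (g base) = v"
  shows "(\<lambda>g. \<iota> (g base)) \<in> iso (G\<lparr>carrier := transl\<rparr>) (F2_group k)"
proof (rule isoI)
  have tr: "\<iota> (g x) = \<iota> (g base) \<boxplus> \<iota> x" if "g \<in> transl" "x \<in> \<Omega>" for g x
    using that affineD(3)[of g id x base] base_in zero
    by (auto simp: transl_def fun_eq_iff)
  show "(\<lambda>g. \<iota> (g base)) \<in> hom (G\<lparr>carrier := transl\<rparr>) (F2_group k)"
  proof (rule homI)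
    fix g assume "g \<in> carrier (G\<lparr>carrier := transl\<rparr>)"
    then have "g base \<in> \<Omega>" using affineD(1) base_in by (auto simp: transl_def)
    then show "\<iota> (g base) \<in> carrier (F2_group k)" using in_V by (simp add: F2_group_def)
  next
    fix g h assume "g \<in> carrier (G\<lparr>carrier := transl\<rparr>)" "h \<in> carrier (G\<lparr>carrier := transl\<rparr>)"
    then have gh: "g \<in> transl" "h \<in> transl" by simp_all
    then have "g base \<in> \<Omega>" using affineD(1) base_in by (auto simp: transl_def)
    then have "\<iota> (h (g base)) = \<iota> (g base) \<boxplus> \<iota> (h base)"
      using tr[OF gh(2)] xadd_comm by metis
    then show "\<iota> ((g \<otimes>\<^bsub>G\<lparr>carrier := transl\<rparr>\<^esub> h) base) = \<iota> (g base) \<otimes>\<^bsub>F2_group k\<^esub> \<iota> (h base)"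
      by (simp add: F2_group_def vadd_eq_xadd)
  qed
  have inj: "g = h" if gh: "g \<in> transl" "h \<in> transl" and eq: "\<iota> (g base) = \<iota> (h base)" for g h
  proof
    fix x
    have ag: "affine g id" "affine h id" using gh by (auto simp: transl_def)
    show "g x = h x"
    proof (cases "x \<in> \<Omega>")
      case True
      then show ?thesis using tr[OF gh(1) True] tr[OF gh(2) True] eq affineD(1)[OF ag(1) True] affineD(1)[OF ag(2) True]
        by (intro \<iota>_eqI) auto
    qed (use affineD(2)[OF ag(1)] affineD(2)[OF ag(2)] in auto)
  qed
  show "bij_betw (\<lambda>g. \<iota> (g base)) (carrier (G\<lparr>carrier := transl\<rparr>)) (carrier (F2_group k))"
  proof (rule bij_betw_imageI)
    show "inj_on (\<lambda>g. \<iota> (g base)) (carrier (G\<lparr>carrier := transl\<rparr>))"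
      using inj by (auto intro: inj_onI)
    show "(\<lambda>g. \<iota> (g base)) ` carrier (G\<lparr>carrier := transl\<rparr>) = carrier (F2_group k)"
    proof (intro equalityI subsetI)
      fix v assume "v \<in> carrier (F2_group k)"
      then obtain g where "g \<in> transl" "\<iota> (g base) = v" using surj by (auto simp: F2_group_def)
      then show "v \<in> (\<lambda>g. \<iota> (g base)) ` carrier (G\<lparr>carrier := transl\<rparr>)" by auto
    next
      fix v assume "v \<in> (\<lambda>g. \<iota> (g base)) ` carrier (G\<lparr>carrier := transl\<rparr>)"
      then obtain g where g: "g \<in> transl" "v = \<iota> (g base)" by auto
      then have "g base \<in> \<Omega>" using affineD(1) base_in by (auto simp: transl_def)
      then show "v \<in> carrier (F2_group k)" using g in_V by (simp add: F2_group_def)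
    qed
  qed
qed

end

section \<open>The linear part as a map onto the symplectic group\<close>

locale symplectic_rep = design_rep \<Omega> B base \<iota> "sympl_form m"
  for \<Omega> :: "'a set" and B :: "'a set set" and base :: 'a and \<iota> :: "'a \<Rightarrow> nat \<Rightarrow> bool" and m :: nat +
  assumes m_pos: "m > 0"
    and \<iota>_in: "a \<in> \<Omega> \<Longrightarrow> \<iota> a \<in> F2vec (2 * m)"
    and \<iota>_base: "\<iota> base = (\<lambda>_. False)"
    and differences: "v \<in> F2vec (2 * m) \<Longrightarrow> \<exists>a\<in>\<Omega>. \<exists>b\<in>\<Omega>. v = \<iota> a \<boxplus> \<iota> b"
begin

lemma affine_move_transv:
  assumes "a \<in> \<Omega>" "b \<in> \<Omega>" shows "affine (elem_move B a b) (transv m (\<iota> a \<boxplus> \<iota> b))"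
  using affine_move[OF assms] \<iota>_in unfolding affine_def transv_def by simp

lemma linear_part_ex:
  assumes "g \<in> L_inf \<Omega> B base" shows "\<exists>\<tau>\<in>carrier (Sp_group m). affine g \<tau>"
proof -
  have "\<exists>\<tau>\<in>carrier (Sp_group m). affine (move_seq B xs) \<tau>" if "set xs \<subseteq> \<Omega>" for xs
    using that
  proof (induction xs rule: induct_list012)
    case 1
    show ?case by (rule bexI[of _ id]) (simp_all only: move_seq.simps affine_id Sp_id_closed)
  next
    case (2 x)
    show ?case by (rule bexI[of _ id]) (simp_all only: move_seq.simps affine_id Sp_id_closed)
  next
    case (3 a b rest)
    then obtain \<tau> where \<tau>: "\<tau> \<in> carrier (Sp_group m)" "affine (move_seq B (b # rest)) \<tau>" by auto
    have ab: "a \<in> \<Omega>" "b \<in> \<Omega>" using 3(3) by auto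
    show ?case
    proof (rule bexI[of _ "\<tau> \<circ> transv m (\<iota> a \<boxplus> \<iota> b)"])
      show "affine (move_seq B (a # b # rest)) (\<tau> \<circ> transv m (\<iota> a \<boxplus> \<iota> b))"
        unfolding move_seq.simps by (rule affine_comp[OF affine_move_transv[OF ab] \<tau>(2)])
      show "\<tau> \<circ> transv m (\<iota> a \<boxplus> \<iota> b) \<in> carrier (Sp_group m)"
        using ab \<iota>_in by (intro Sp_comp_closed \<tau> transv_Sp) simp
    qed
  qed
  then show ?thesis using assms by (auto elim!: L_infE)
qed

text \<open>Every vector of the space is a difference of points, and outside the space all members
  of \<open>Sp_group\<close> are the identity.\<close>

lemma linear_part_unique:
  assumes "affine g \<sigma>" "affine g \<tau>" "\<sigma> \<in> carrier (Sp_group m)" "\<tau> \<in> carrier (Sp_group m)"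
  shows "\<sigma> = \<tau>"
proof
  fix v show "\<sigma> v = \<tau> v"
  proof (cases "v \<in> F2vec (2 * m)")
    case True
    then obtain a b where "a \<in> \<Omega>" "b \<in> \<Omega>" "v = \<iota> a \<boxplus> \<iota> b" using differences by blast
    then show ?thesis using affineD(3)[OF assms(1)] affineD(3)[OF assms(2)] by metis
  qed (use assms Sp_carrierD(2) in metis)
qed

text \<open>Every vector is a difference of points, so every transvection is the linear part of a
  move, and transvections generate the symplectic group.\<close>

lemma linear_part_surj:
  assumes "\<tau> \<in> carrier (Sp_group m)" shows "\<exists>g\<in>L_inf \<Omega> B base. affine g \<tau>"
  using assms
proof (induction rule: Sp_transv_induct)
  case id
  show ?case using id_L_inf affine_id by blast
next
  case (transv e f)
  then obtain g where g: "g \<in> L_inf \<Omega> B base" "affine g f" by blast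
  obtain a b where ab: "a \<in> \<Omega>" "b \<in> \<Omega>" "e = \<iota> a \<boxplus> \<iota> b" using differences transv by blast
  show ?case
    using affine_comp[OF g(2) affine_move_transv[OF ab(1,2)]] move_comp_L_inf[OF g(1) ab(1,2)] ab(3) by blast
qed

definition lin :: "('a \<Rightarrow> 'a) \<Rightarrow> (nat \<Rightarrow> bool) \<Rightarrow> nat \<Rightarrow> bool" where
  "lin g = (SOME \<tau>. \<tau> \<in> carrier (Sp_group m) \<and> affine g \<tau>)"

lemma lin:
  assumes "g \<in> L_inf \<Omega> B base"
  shows "lin g \<in> carrier (Sp_group m)" "affine g (lin g)"
proof -
  have "\<exists>\<tau>. \<tau> \<in> carrier (Sp_group m) \<and> affine g \<tau>" using linear_part_ex[OF assms] by blast
  then have "lin g \<in> carrier (Sp_group m) \<and> affine g (lin g)" unfolding lin_def by (rule someI_ex)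
  then show "lin g \<in> carrier (Sp_group m)" "affine g (lin g)" by auto
qed

lemma lin_eqI: "g \<in> L_inf \<Omega> B base \<Longrightarrow> \<tau> \<in> carrier (Sp_group m) \<Longrightarrow> affine g \<tau> \<Longrightarrow> lin g = \<tau>"
  using linear_part_unique lin by blast

text \<open>Products in \<open>G\<close> are composed left to right but in \<open>Sp_group\<close> right to left, so the linear part
  is an antihomomorphism; composing with inversion repairs this.\<close>
definition rho :: "('a \<Rightarrow> 'a) \<Rightarrow> (nat \<Rightarrow> bool) \<Rightarrow> nat \<Rightarrow> bool" where
  "rho g = inv\<^bsub>Sp_group m\<^esub> (lin g)"

lemma group_hom_rho: "group_hom G (Sp_group m) rho"
proof -
  interpret S: group "Sp_group m" by (rule group_Sp)
  have "rho \<in> hom G (Sp_group m)"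
  proof (rule homI)
    fix g assume "g \<in> carrier G"
    then show "rho g \<in> carrier (Sp_group m)" using lin by (simp add: rho_def)
  next
    fix g h assume "g \<in> carrier G" "h \<in> carrier G"
    then have gh: "g \<in> L_inf \<Omega> B base" "h \<in> L_inf \<Omega> B base" by simp_all
    have "h \<circ> g \<in> L_inf \<Omega> B base"
      using move_seq_comp_L_inf[OF gh(1)] gh(2) by (auto elim!: L_infE)
    then have "lin (h \<circ> g) = lin h \<otimes>\<^bsub>Sp_group m\<^esub> lin g"
      using lin gh by (intro lin_eqI) (auto intro: affine_comp Sp_comp_closed)
    then show "rho (g \<otimes>\<^bsub>G\<^esub> h) = rho g \<otimes>\<^bsub>Sp_group m\<^esub> rho h"
      unfolding rho_def G_simps using S.inv_mult_group[OF lin(1)[OF gh(2)] lin(1)[OF gh(1)]] by (simp only:)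
  qed
  then show ?thesis by (intro group_hom.intro group_hom_axioms.intro group_G group_Sp)
qed

lemma rho_surj: "rho ` carrier G = carrier (Sp_group m)"
proof (intro equalityI subsetI)
  interpret S: group "Sp_group m" by (rule group_Sp)
  fix \<tau> assume \<tau>: "\<tau> \<in> carrier (Sp_group m)"
  then have i: "inv\<^bsub>Sp_group m\<^esub> \<tau> \<in> carrier (Sp_group m)" by simp
  then obtain g where g: "g \<in> L_inf \<Omega> B base" "affine g (inv\<^bsub>Sp_group m\<^esub> \<tau>)"
    using linear_part_surj by blast
  then have "lin g = inv\<^bsub>Sp_group m\<^esub> \<tau>" using lin_eqI i by blast
  then have "rho g = \<tau>" using \<tau> by (simp add: rho_def)
  then show "\<tau> \<in> rho ` carrier G" using g(1) by force
next
  fix \<tau> assume "\<tau> \<in> rho ` carrier G"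
  then show "\<tau> \<in> carrier (Sp_group m)" using group_hom.hom_closed[OF group_hom_rho] by blast
qed

lemma kernel_rho: "kernel G (Sp_group m) rho = transl"
proof -
  interpret S: group "Sp_group m" by (rule group_Sp)
  have "rho g = \<one>\<^bsub>Sp_group m\<^esub> \<longleftrightarrow> affine g id" if g: "g \<in> L_inf \<Omega> B base" for g
  proof -
    have "rho g = \<one>\<^bsub>Sp_group m\<^esub> \<longleftrightarrow> lin g = \<one>\<^bsub>Sp_group m\<^esub>"
      unfolding rho_def using S.inv_eq_1_iff[OF lin(1)[OF g]] .
    also have "\<dots> \<longleftrightarrow> affine g id"
      using lin[OF g] lin_eqI[OF g Sp_id_closed] by auto
    finally show ?thesis .
  qed
  then show ?thesis by (auto simp: kernel_def transl_def)
qed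

section \<open>Periods of the point set\<close>

definition pts :: "(nat \<Rightarrow> bool) set" where
  "pts = \<iota> ` \<Omega>"

lemma pts_sub: "pts \<subseteq> F2vec (2 * m)"
  using \<iota>_in by (auto simp: pts_def)

lemma zero_pts: "(\<lambda>_. False) \<in> pts"
  using \<iota>_base base_in by (force simp: pts_def)

lemma card_pts: "card pts = card \<Omega>"
  unfolding pts_def by (rule card_image[OF \<iota>_inj])

text \<open>The move of the points \<open>u\<close> and \<open>u + e\<close> takes \<open>x\<close>
  to \<open>x + e\<close>, because \<open>e\<close> is orthogonal to \<open>u + x\<close>.\<close>

lemma pts_closed:
  assumes "u \<in> pts" "u \<boxplus> e \<in> pts" "x \<in> pts" "sympl_form m e u = sympl_form m e x"
  shows "x \<boxplus> e \<in> pts"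
proof -
  obtain a b y where ab: "a \<in> \<Omega>" "b \<in> \<Omega>" "y \<in> \<Omega>" "u = \<iota> a" "u \<boxplus> e = \<iota> b" "x = \<iota> y"
    using assms(1-3) by (auto simp: pts_def)
  then have e: "\<iota> a \<boxplus> \<iota> b = e" by (metis xadd_left_cancel)
  have "\<iota> (elem_move B a b y) = x \<boxplus> e"
    using \<iota>_move[OF ab(1-3)] assms(4) unfolding e by (simp add: ab(4,6)[symmetric])
  then show ?thesis using move_in[OF ab(1-3)] by (metis imageI pts_def)
qed

text \<open>A vector not orthogonal to \<open>e\<close> is a difference of two points, so one of
  these is not orthogonal to \<open>e\<close>.\<close>

lemma pts_separate:
  assumes "e \<in> F2vec (2 * m)" "e \<noteq> (\<lambda>_. False)"
  obtains x where "x \<in> pts" "sympl_form m e x"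
proof -
  obtain w where w: "w \<in> F2vec (2 * m)" "sympl_form m e w" using sympl_form_nondegenerate assms by blast
  obtain a b where "a \<in> \<Omega>" "b \<in> \<Omega>" "w = \<iota> a \<boxplus> \<iota> b" using differences w(1) by blast
  then show ?thesis using w(2) that[of "\<iota> a"] that[of "\<iota> b"] by (auto simp: pts_def)
qed

definition period :: "(nat \<Rightarrow> bool) \<Rightarrow> bool" where
  "period e \<longleftrightarrow> (\<forall>x\<in>pts. x \<boxplus> e \<in> pts)"

lemma period_add: "period e \<Longrightarrow> period f \<Longrightarrow> period (e \<boxplus> f)"
  unfolding period_def by (metis xadd_assoc)

text \<open>Conjugating the translation by \<open>e\<close> with a move of difference
  \<open>f\<close> gives the translation by \<open>e + f\<close>; then \<open>f\<close> is a sum of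
  two periods.\<close>

lemma period_transv:
  assumes "period e" "e \<in> F2vec (2 * m)" "f \<in> F2vec (2 * m)" "sympl_form m e f"
  shows "period f"
proof -
  obtain a b where ab: "a \<in> \<Omega>" "b \<in> \<Omega>" "f = \<iota> a \<boxplus> \<iota> b" using differences assms(3) by blast
  have "period (e \<boxplus> f)"
    unfolding period_def
  proof
    fix x assume "x \<in> pts"
    then obtain p where p: "p \<in> \<Omega>" "x = \<iota> p" by (auto simp: pts_def)
    let ?q = "elem_move B a b p"
    have q: "?q \<in> \<Omega>" using p ab move_in by blast
    then have "\<iota> ?q \<boxplus> e \<in> pts" using assms(1) by (auto simp: period_def pts_def)
    then obtain r where r: "r \<in> \<Omega>" "\<iota> r = \<iota> ?q \<boxplus> e" by (auto simp: pts_def)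
    have "\<iota> (elem_move B a b ?q) \<boxplus> \<iota> (elem_move B a b r) = transv m f (\<iota> ?q \<boxplus> \<iota> r)"
      using affineD(3)[OF affine_move_transv[OF ab(1,2)] q r(1)] ab(3) by simp
    also have "\<iota> ?q \<boxplus> \<iota> r = e" using r(2) by simp
    also have "transv m f e = e \<boxplus> f" using assms sympl_form_sym[of m f e] by (simp add: transv_def)
    finally have "\<iota> (elem_move B a b r) = x \<boxplus> (e \<boxplus> f)"
      using move_invol ab p by (metis xadd_left_cancel)
    then show "x \<boxplus> (e \<boxplus> f) \<in> pts" using move_in ab r by (metis imageI pts_def)
  qed
  then have "period (e \<boxplus> (e \<boxplus> f))" using assms(1) period_add by blast
  then show ?thesis by simp
qed

text \<open>A vector orthogonal to \<open>e\<close> is a sum of two vectors that are not, and these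
  are periods by \<open>period_transv\<close>. Since zero is a point, every vector is one.\<close>

lemma period_all:
  assumes "period e" "e \<in> F2vec (2 * m)" "e \<noteq> (\<lambda>_. False)"
  shows "pts = F2vec (2 * m)"
proof (intro equalityI subsetI)
  fix f assume f: "f \<in> F2vec (2 * m)"
  have "period f"
  proof (cases "sympl_form m e f")
    case True
    then show ?thesis using period_transv assms f by blast
  next
    case False
    obtain w where w: "w \<in> F2vec (2 * m)" "sympl_form m e w" using sympl_form_nondegenerate assms by blast
    then have "period w" "period (f \<boxplus> w)" using period_transv[OF assms(1,2)] f False by auto
    then have "period (w \<boxplus> (f \<boxplus> w))" using period_add by blast
    moreover have "w \<boxplus> (f \<boxplus> w) = f" by auto
    ultimately show ?thesis by simp
  qed
  then show "f \<in> pts" using zero_pts unfolding period_def by (metis xadd_simps(3))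
qed (use pts_sub in auto)

text \<open>For \<open>w\<close> not orthogonal to \<open>e\<close>, the moves of the pairs
  \<open>0\<close>, \<open>e\<close> and \<open>w\<close>, \<open>w + e\<close> shift complementary
  sets of points by \<open>e\<close>. Their product shifts every point.\<close>

lemma transl_full:
  assumes full: "pts = F2vec (2 * m)" and e: "e \<in> F2vec (2 * m)"
  shows "\<exists>g\<in>transl. \<iota> (g base) = e"
proof (cases "e = (\<lambda>_. False)")
  case True
  have "id \<in> transl" using id_L_inf affine_id by (simp add: transl_def)
  then show ?thesis using True \<iota>_base by (intro bexI[of _ id]) auto
next
  case False
  obtain w where w: "w \<in> F2vec (2 * m)" "sympl_form m e w" using sympl_form_nondegenerate e False by blast
  have "e \<in> \<iota> ` \<Omega>" "w \<in> \<iota> ` \<Omega>" "w \<boxplus> e \<in> \<iota> ` \<Omega>"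
    using e w full[symmetric] xadd_F2vec[OF w(1) e] by (auto simp: pts_def)
  then obtain b c d where b: "b \<in> \<Omega>" "\<iota> b = e" and c: "c \<in> \<Omega>" "\<iota> c = w" and d: "d \<in> \<Omega>" "\<iota> d = w \<boxplus> e"
    by (metis imageE)
  define g where "g = elem_move B c d \<circ> elem_move B base b"
  have g_in: "g \<in> L_inf \<Omega> B base"
    unfolding g_def using b c d base_in by (intro move_comp_L_inf move_L_inf)
  have gx: "\<iota> (g x) = \<iota> x \<boxplus> e" if x: "x \<in> \<Omega>" for x
  proof -
    let ?y = "elem_move B base b x"
    have y: "?y \<in> \<Omega>" using x b base_in move_in by blast
    have 1: "\<iota> ?y = \<iota> x \<boxplus> scale2 (\<not> sympl_form m e (\<iota> x)) e"
      using \<iota>_move[OF base_in b(1) x] b \<iota>_base by simp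
    have "\<iota> c \<boxplus> \<iota> d = e" using c d by simp
    then have "\<iota> (g x) = \<iota> ?y \<boxplus> scale2 (\<not> sympl_form m e (w \<boxplus> \<iota> ?y)) e"
      using \<iota>_move[OF c(1) d(1) y] c(2) by (simp add: g_def)
    also have "\<dots> = \<iota> x \<boxplus> e" unfolding 1 using w(2) by (auto simp: fun_eq_iff)
    finally show ?thesis .
  qed
  have "affine g id"
    unfolding affine_def
  proof (intro conjI ballI allI impI)
    show "g x \<in> \<Omega>" if "x \<in> \<Omega>" for x using that b c d base_in move_in by (simp add: g_def)
    show "g x = x" if "x \<notin> \<Omega>" for x using that b c d base_in move_outside by (simp add: g_def)
    show "\<iota> (g x) \<boxplus> \<iota> (g y) = id (\<iota> x \<boxplus> \<iota> y)" if "x \<in> \<Omega>" "y \<in> \<Omega>" for x y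
      using gx[OF that(1)] gx[OF that(2)] by auto
  qed
  then have "g \<in> transl" using g_in by (simp add: transl_def)
  then show ?thesis using gx[OF base_in] \<iota>_base by (intro bexI[of _ g]) simp_all
qed

lemma full_case:
  assumes "pts = F2vec (2 * m)"
  shows "card \<Omega> = 2 ^ (2 * m) \<and> is_2_2m_Sp m G"
proof
  show "card \<Omega> = 2 ^ (2 * m)" using card_pts assms card_F2vec by metis
  interpret group_hom G "Sp_group m" rho by (rule group_hom_rho)
  have "(G\<lparr>carrier := transl\<rparr>) \<cong> F2_group (2 * m)"
    using transl_iso[OF \<iota>_base \<iota>_in transl_full[OF assms]] unfolding is_iso_def by blast
  moreover have "transl \<lhd> G" using normal_kernel unfolding kernel_rho .
  moreover have "G Mod transl \<cong> Sp_group m"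
    using FactGroup_iso[OF rho_surj] unfolding kernel_rho .
  ultimately show "is_2_2m_Sp m G" unfolding is_2_2m_Sp_def by blast
qed

section \<open>The quadric in the absence of periods\<close>

definition quad :: "(nat \<Rightarrow> bool) \<Rightarrow> bool" where
  "quad e \<longleftrightarrow> (\<exists>u\<in>pts. u \<boxplus> e \<in> pts \<and> sympl_form m e u)"

context
  assumes no_period: "\<And>e. e \<in> F2vec (2 * m) \<Longrightarrow> e \<noteq> (\<lambda>_. False) \<Longrightarrow> \<not> period e"
begin

text \<open>If points \<open>u\<close> with \<open>u + e\<close> a point occurred for both values of
  \<open>sympl_form m e u\<close>, then by \<open>pts_closed\<close> the vector \<open>e\<close>
  would be a period. Hence for nonzero \<open>e\<close> only one value occurs, and this is
  \<open>quad e\<close>.\<close>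

lemma quad_iff:
  assumes e: "e \<in> F2vec (2 * m)" and x: "x \<in> pts"
  shows "x \<boxplus> e \<in> pts \<longleftrightarrow> sympl_form m e x = quad e"
proof (cases "e = (\<lambda>_. False)")
  case True
  then show ?thesis using x by (simp add: quad_def)
next
  case False
  have same: "sympl_form m e u = sympl_form m e v"
    if "u \<in> pts" "u \<boxplus> e \<in> pts" "v \<in> pts" "v \<boxplus> e \<in> pts" for u v
  proof (rule ccontr)
    assume ne: "sympl_form m e u \<noteq> sympl_form m e v"
    have "period e"
      unfolding period_def
    proof
      fix y assume "y \<in> pts"
      then show "y \<boxplus> e \<in> pts" using pts_closed[of u e y] pts_closed[of v e y] that ne by auto
    qed
    then show False using no_period e False by blast
  qed
  obtain a b where "a \<in> \<Omega>" "b \<in> \<Omega>" "e = \<iota> a \<boxplus> \<iota> b" using differences e by blast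
  then have u: "\<iota> a \<in> pts" "\<iota> a \<boxplus> e \<in> pts" by (auto simp: pts_def)
  then have "quad e \<longleftrightarrow> sympl_form m e (\<iota> a)" using same unfolding quad_def by blast
  then show ?thesis using same[OF u x] pts_closed[OF u x] by blast
qed

text \<open>This is \<open>quad_iff\<close> at the origin, which is a point.\<close>

lemma pts_quad: "pts = {v \<in> F2vec (2 * m). \<not> quad v}"
  using quad_iff[OF _ zero_pts] pts_sub by auto

text \<open>If \<open>v\<close> or \<open>w\<close> is a zero of \<open>quad\<close>, the identity
  is \<open>quad_iff\<close> at that point. If neither is, nonorthogonal \<open>v\<close> and
  \<open>w\<close> are settled by using \<open>v + w\<close> as the point, and orthogonal ones by an
  auxiliary point.\<close>

lemma quad_quadratic:
  assumes v: "v \<in> F2vec (2 * m)" and w: "w \<in> F2vec (2 * m)"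
  shows "quad (v \<boxplus> w) \<longleftrightarrow> (quad v \<noteq> (quad w \<noteq> sympl_form m v w))"
proof -
  have P: "quad (x \<boxplus> e) \<longleftrightarrow> quad e \<noteq> sympl_form m e x" if "x \<in> F2vec (2 * m)" "e \<in> F2vec (2 * m)" "\<not> quad x" for x e
    using quad_iff[of e x] that by (auto simp: pts_quad)
  have sym: "sympl_form m v w = sympl_form m w v" by (rule sympl_form_sym)
  consider "\<not> quad v" | "\<not> quad w" | "quad v" "quad w" "sympl_form m v w" | "quad v" "quad w" "\<not> sympl_form m v w"
    by blast
  then show ?thesis
  proof cases
    case 1
    then show ?thesis using P[OF v w] sym by blast
  next
    case 2
    then show ?thesis using P[OF w v] sym xadd_comm[of v w] by simp
  next
    case 3
    have "quad (v \<boxplus> w)"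
    proof (rule ccontr)
      assume "\<not> quad (v \<boxplus> w)"
      then have "quad (v \<boxplus> w \<boxplus> w) \<longleftrightarrow> quad w \<noteq> sympl_form m w (v \<boxplus> w)"
        using P[of "v \<boxplus> w" w] v w by simp
      moreover have "v \<boxplus> w \<boxplus> w = v" by auto
      ultimately show False using 3 sym by simp
    qed
    then show ?thesis using 3 by simp
  next
    case 4
    have "\<not> quad (v \<boxplus> w)"
    proof
      assume vw: "quad (v \<boxplus> w)"
      have "v \<noteq> (\<lambda>_. False)" using 4(1) by (auto simp: quad_def)
      \<comment> \<open>As \<open>y\<close> is not orthogonal to \<open>v\<close>, also
        \<open>y + v\<close> is a point. Reaching \<open>y + v + w\<close> from \<open>y\<close> and
        from \<open>y + v\<close> gives contradictory values.\<close>
      then obtain y where y: "y \<in> pts" "sympl_form m v y" using pts_separate v by blast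
      then have yV: "y \<in> F2vec (2 * m)" "\<not> quad y" by (auto simp: pts_quad)
      have "\<not> quad (y \<boxplus> v)" using P[OF yV(1) v yV(2)] 4 y by simp
      then have "quad (y \<boxplus> v \<boxplus> w) \<longleftrightarrow> quad w \<noteq> sympl_form m w (y \<boxplus> v)"
        using P[of "y \<boxplus> v" w] yV v w by simp
      moreover have "quad (y \<boxplus> (v \<boxplus> w)) \<longleftrightarrow> quad (v \<boxplus> w) \<noteq> sympl_form m (v \<boxplus> w) y"
        using P[of y "v \<boxplus> w"] yV v w by simp
      ultimately show False using 4 y vw sym by (simp add: xadd_assoc)
    qed
    then show ?thesis using 4 by simp
  qed
qed

text \<open>The vector of a translation is a period of the point set, hence zero.\<close>

lemma transl_trivial: "transl = {id}"
proof (intro equalityI subsetI)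
  fix g assume "g \<in> transl"
  then have g: "affine g id" by (simp add: transl_def)
  let ?t = "\<iota> (g base)"
  have gx: "\<iota> (g x) = \<iota> x \<boxplus> ?t" if "x \<in> \<Omega>" for x
    using affineD(3)[OF g that base_in] \<iota>_base by (auto simp: fun_eq_iff)
  have "period ?t"
    unfolding period_def
  proof
    fix x assume "x \<in> pts"
    then obtain p where p: "p \<in> \<Omega>" "x = \<iota> p" by (auto simp: pts_def)
    then have "x \<boxplus> ?t = \<iota> (g p)" using gx by simp
    then show "x \<boxplus> ?t \<in> pts" using affineD(1)[OF g p(1)] by (simp add: pts_def)
  qed
  then have "?t = (\<lambda>_. False)" using no_period \<iota>_in[OF affineD(1)[OF g base_in]] by blast
  then have eq: "\<iota> (g x) = \<iota> x" if "x \<in> \<Omega>" for x using gx[OF that] by simp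
  have "g x = id x" for x
  proof (cases "x \<in> \<Omega>")
    case True
    then show ?thesis using \<iota>_eqI[OF eq affineD(1)[OF g]] by simp
  qed (simp add: affineD(2)[OF g])
  then have "g = id" by (rule ext)
  then show "g \<in> {id}" by simp
qed (use id_L_inf affine_id in \<open>simp add: transl_def\<close>)

lemma quadric_case:
  "(card \<Omega> = 2 ^ (m - 1) * (2 ^ m + 1) \<or> card \<Omega> = 2 ^ (m - 1) * (2 ^ m - 1)) \<and> G \<cong> Sp_group m"
proof
  show "card \<Omega> = 2 ^ (m - 1) * (2 ^ m + 1) \<or> card \<Omega> = 2 ^ (m - 1) * (2 ^ m - 1)"
    using card_quadric[OF quad_quadratic m_pos] unfolding pts_quad[symmetric] card_pts .
  interpret group_hom G "Sp_group m" rho by (rule group_hom_rho)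
  have "inj_on rho (carrier G)"
    using inj_iff_trivial_ker kernel_rho transl_trivial by simp
  then have "rho \<in> iso G (Sp_group m)"
    using rho_surj homh by (auto simp: iso_def bij_betw_def)
  then show "G \<cong> Sp_group m" unfolding is_iso_def by blast
qed

end

lemma classification:
  "((card \<Omega> = 2 ^ (m - 1) * (2 ^ m + 1) \<or> card \<Omega> = 2 ^ (m - 1) * (2 ^ m - 1)) \<and> G \<cong> Sp_group m)
    \<or> (card \<Omega> = 2 ^ (2 * m) \<and> is_2_2m_Sp m G)"
proof (cases "\<exists>e\<in>F2vec (2 * m). e \<noteq> (\<lambda>_. False) \<and> period e")
  case True
  then show ?thesis using full_case period_all by (intro disjI2) auto
next
  case False
  then show ?thesis by (intro disjI1 quadric_case) auto
qed

end

section \<open>Coordinates for the points\<close>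

context two_graph_design begin

text \<open>The form on differences, obtained by evaluating \<open>u\<close> at both ends of a pair
  representing \<open>v\<close>. That the pair does not matter is shown in
  \<open>dform_dif\<close>.\<close>

definition dform :: "('a \<Rightarrow> bool) \<Rightarrow> ('a \<Rightarrow> bool) \<Rightarrow> bool" where
  "dform u v \<longleftrightarrow> (\<exists>a\<in>\<Omega>. \<exists>b\<in>\<Omega>. v = dif a b \<and> u a \<noteq> u b)"

text \<open>Both sides are the sum of the same four entries of the symmetric matrix
  \<open>fn\<close>.\<close>

lemma dif_swap:
  assumes "a \<in> \<Omega>" "b \<in> \<Omega>" "c \<in> \<Omega>" "d \<in> \<Omega>"
  shows "(dif a b c \<noteq> dif a b d) \<longleftrightarrow> (dif c d a \<noteq> dif c d b)"
  using assms fn_sym[of a c] fn_sym[of a d] fn_sym[of b c] fn_sym[of b d] by (auto simp: dif_def)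

lemma dform_dif:
  assumes "u \<in> difs" "a \<in> \<Omega>" "b \<in> \<Omega>"
  shows "dform u (dif a b) \<longleftrightarrow> u a \<noteq> u b"
proof -
  obtain c d where cd: "u = dif c d" "c \<in> \<Omega>" "d \<in> \<Omega>" using assms(1) by (auto simp: difs_def)
  have "u a' \<noteq> u b' \<longleftrightarrow> u a \<noteq> u b" if "a' \<in> \<Omega>" "b' \<in> \<Omega>" "dif a b = dif a' b'" for a' b'
    using dif_swap[OF cd(2,3) assms(2,3)] dif_swap[OF cd(2,3) that(1,2)] that(3) cd(1) by simp
  then show ?thesis unfolding dform_def using assms by blast
qed

lemma dif_in_difs: "a \<in> \<Omega> \<Longrightarrow> b \<in> \<Omega> \<Longrightarrow> dif a b \<in> difs"
  by (auto simp: difs_def)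

lemma two_points: "\<exists>a\<in>\<Omega>. a \<noteq> base"
proof (rule ccontr)
  assume "\<not> ?thesis"
  then have "\<Omega> \<subseteq> {base}" by blast
  moreover obtain L where L: "L \<in> B" using B_nonempty by blast
  ultimately have "card L \<le> card {base}" using line_sub[OF L] by (intro card_mono) auto
  then show False using line_card[OF L] by simp
qed

lemma elem_move_self: "elem_move B a a x = x"
  by (simp add: elem_move_def)

lemma move_in_points:
  assumes "a \<in> \<Omega>" "b \<in> \<Omega>" "x \<in> \<Omega>" shows "elem_move B a b x \<in> \<Omega>"
proof (cases "a = b \<or> ncol a b x")
  case True
  then have "elem_move B a b x = x" using elem_move_self elem_move_ncol by blast
  then show ?thesis using assms by simp
next
  case False
  then have ne: "a \<noteq> b" "\<not> ncol a b x" by auto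
  then show ?thesis
    by (cases rule: elem_move_collinear_cases[of a b x]) (use assms line_points in auto)
qed

text \<open>The differences form a symplectic space under \<open>dform\<close>, with coordinates
  \<open>h\<close>. A point \<open>a\<close> receives the coordinates of \<open>dif a base\<close>,
  and the noncollinear triple makes this injective.\<close>

lemma symplectic_case:
  assumes "ncol p q r" "p \<in> \<Omega>" "q \<in> \<Omega>" "r \<in> \<Omega>"
  shows "\<exists>m \<iota>. symplectic_rep \<Omega> B base \<iota> m"
proof -
  have fin_difs: "finite difs"
  proof -
    have "difs = (\<lambda>(a, b). dif a b) ` (\<Omega> \<times> \<Omega>)" by (auto simp: difs_def)
    then show ?thesis using fin by simp
  qed
  have zero: "(\<lambda>_. False) \<in> difs" using dif_in_difs[OF base_in base_in] by (simp add: dif_rules(1))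
  have add: "dform (u \<boxplus> v) w \<longleftrightarrow> dform u w \<noteq> dform v w" if uvw: "u \<in> difs" "v \<in> difs" "w \<in> difs" for u v w
  proof -
    obtain a b where "w = dif a b" "a \<in> \<Omega>" "b \<in> \<Omega>" using uvw(3) by (auto simp: difs_def)
    then show ?thesis using uvw difs_closed by (auto simp: dform_dif)
  qed
  have sym: "dform u v \<longleftrightarrow> dform v u" if uv: "u \<in> difs" "v \<in> difs" for u v
  proof -
    obtain a b where "v = dif a b" "a \<in> \<Omega>" "b \<in> \<Omega>" using uv(2) by (auto simp: difs_def)
    moreover obtain c d where "u = dif c d" "c \<in> \<Omega>" "d \<in> \<Omega>" using uv(1) by (auto simp: difs_def)
    ultimately show ?thesis using dif_swap[of c d a b] by (simp add: dform_dif dif_in_difs)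
  qed
  have alt: "\<not> dform v v" if v: "v \<in> difs" for v
  proof -
    obtain a b where "v = dif a b" "a \<in> \<Omega>" "b \<in> \<Omega>" using v by (auto simp: difs_def)
    then show ?thesis using fn_sym[of a b] dif_in_difs[of a b] dform_dif[of "dif a b" a b] by (auto simp: dif_def)
  qed
  \<comment> \<open>A nonzero \<open>v\<close> is true at some point \<open>x\<close> and false at
    \<open>base\<close>, hence pairs nontrivially with \<open>dif x base\<close>.\<close>
  have nondeg: "\<exists>w\<in>difs. dform v w" if v: "v \<in> difs" "v \<noteq> (\<lambda>_. False)" for v
  proof -
    obtain x where x: "v x" using v(2) by (auto simp: fun_eq_iff)
    have "x \<in> \<Omega>" "\<not> v base" using x v(1) dif_outside dif_base by (auto simp: difs_def)
    then show ?thesis using dform_dif[OF v(1), of x base] x base_in dif_in_difs by blast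
  qed
  have "\<exists>m h. bij_betw h difs (F2vec (2 * m)) \<and> (\<forall>v\<in>difs. \<forall>w\<in>difs. h (v \<boxplus> w) = h v \<boxplus> h w)
    \<and> (\<forall>v\<in>difs. \<forall>w\<in>difs. sympl_form m (h v) (h w) = dform v w)"
    by (rule symplectic_coordinates[OF fin_difs zero difs_closed add sym alt nondeg])
  then obtain m h where h: "bij_betw h difs (F2vec (2 * m))"
    and h_add: "\<And>v w. v \<in> difs \<Longrightarrow> w \<in> difs \<Longrightarrow> h (v \<boxplus> w) = h v \<boxplus> h w"
    and h_form: "\<And>v w. v \<in> difs \<Longrightarrow> w \<in> difs \<Longrightarrow> sympl_form m (h v) (h w) = dform v w"
    by blast
  define \<iota> where "\<iota> a = h (dif a base)" for a
  have h_in: "h v \<in> F2vec (2 * m)" if "v \<in> difs" for v using h that bij_betwE by blast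
  have h_inj: "v = w" if "h v = h w" "v \<in> difs" "w \<in> difs" for v w
    using h that by (metis bij_betw_inv_into_left)
  have \<iota>_dif: "\<iota> a \<boxplus> \<iota> b = h (dif a b)" if "a \<in> \<Omega>" "b \<in> \<Omega>" for a b
  proof -
    have "dif a base \<boxplus> dif b base = dif a b" using dif_rules(2,3) by metis
    then show ?thesis unfolding \<iota>_def using h_add[of "dif a base" "dif b base"] dif_in_difs that base_in by simp
  qed
  have h0: "h (\<lambda>_. False) = (\<lambda>_. False)" using h_add[OF zero zero] by simp
  have \<iota>_ncol: "sympl_form m (\<iota> a \<boxplus> \<iota> b) (\<iota> a \<boxplus> \<iota> x) \<longleftrightarrow> ncol a b x"
    if "a \<in> \<Omega>" "b \<in> \<Omega>" "x \<in> \<Omega>" for a b x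
    using that dif_ncol[OF that] by (auto simp: \<iota>_dif h_form dif_in_difs dform_dif)
  have inj: "inj_on \<iota> \<Omega>"
  proof (rule inj_onI, rule ccontr)
    fix a b assume ab: "a \<in> \<Omega>" "b \<in> \<Omega>" "\<iota> a = \<iota> b" "a \<noteq> b"
    then have "h (dif a b) = h (\<lambda>_. False)" using \<iota>_dif[of a b] h0 by simp
    then have "dif a b = (\<lambda>_. False)" using h_inj dif_in_difs ab zero by blast
    then show False using difs_nonzero[OF assms ab(1,2,4)] by simp
  qed
  have move: "\<iota> (elem_move B a b x) = \<iota> x \<boxplus> scale2 (\<not> sympl_form m (\<iota> a \<boxplus> \<iota> b) (\<iota> a \<boxplus> \<iota> x)) (\<iota> a \<boxplus> \<iota> b)"
    if "a \<in> \<Omega>" "b \<in> \<Omega>" "x \<in> \<Omega>" for a b x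
  proof (cases "a = b \<or> ncol a b x")
    case True
    then have "elem_move B a b x = x" using elem_move_self elem_move_ncol by blast
    then show ?thesis unfolding \<iota>_ncol[OF that] using True by auto
  next
    case False
    then have ne: "a \<noteq> b" "\<not> ncol a b x" by auto
    have "\<iota> (elem_move B a b x) = \<iota> x \<boxplus> (\<iota> a \<boxplus> \<iota> b)"
      using ne
    proof (cases rule: elem_move_collinear_cases)
      case (3 y)
      then have "\<iota> a \<boxplus> \<iota> b = \<iota> x \<boxplus> \<iota> y"
        using \<iota>_dif that line_points[OF 3(1)] line_dif[OF 3(1)] by simp
      then show ?thesis using 3(2) by simp
    qed auto
    then show ?thesis unfolding \<iota>_ncol[OF that] using ne by simp
  qed
  have \<iota>_in: "\<iota> a \<in> F2vec (2 * m)" if "a \<in> \<Omega>" for a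
    unfolding \<iota>_def using h_in dif_in_difs that base_in by simp
  have \<iota>_base: "\<iota> base = (\<lambda>_. False)" unfolding \<iota>_def by (simp add: dif_rules(1) h0)
  have "m > 0"
  proof (rule ccontr)
    assume "\<not> m > 0"
    then have "F2vec (2 * m) = {\<lambda>_. False}" by (auto simp: F2vec_def)
    moreover obtain a where a: "a \<in> \<Omega>" "a \<noteq> base" using two_points by blast
    ultimately have "\<iota> a = \<iota> base" using \<iota>_in[OF a(1)] \<iota>_base by simp
    then show False using inj_onD[OF inj _ a(1) base_in] a(2) by simp
  qed
  have differences: "\<exists>a\<in>\<Omega>. \<exists>b\<in>\<Omega>. v = \<iota> a \<boxplus> \<iota> b" if v: "v \<in> F2vec (2 * m)" for v
  proof -
    obtain u where u: "u \<in> difs" "v = h u" using h v by (metis bij_betw_imp_surj_on imageE)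
    then obtain a b where "u = dif a b" "a \<in> \<Omega>" "b \<in> \<Omega>" by (auto simp: difs_def)
    then show ?thesis using \<iota>_dif u by metis
  qed
  have "symplectic_rep \<Omega> B base \<iota> m"
  proof
    show "sympl_form m v w = sympl_form m w v" for v w by (rule sympl_form_sym)
  qed (fact base_in inj sympl_form_add_left sympl_form_self move_in_points elem_move_outside
      move \<open>m > 0\<close> \<iota>_in \<iota>_base differences)+
  then show ?thesis by blast
qed

section \<open>The affine space formed by the points when all triples are collinear\<close>

text \<open>If all triples are collinear, this will be the relation \<open>a + b = x + y\<close>.\<close>
definition par :: "'a \<Rightarrow> 'a \<Rightarrow> 'a \<Rightarrow> 'a \<Rightarrow> bool" where
  "par a b x y \<longleftrightarrow> (a = b \<and> x = y) \<or> (a = x \<and> b = y) \<or> (a = y \<and> b = x) \<or> {a, b, x, y} \<in> B"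

lemma par_sym: "par a b x y \<Longrightarrow> par b a x y" "par a b x y \<Longrightarrow> par a x b y" "par a b x y \<Longrightarrow> par x y a b"
  unfolding par_def by (auto simp: insert_commute)

text \<open>For two different lines this is \<open>lines_symdiff\<close>; in the degenerate cases
  one relation can be substituted into the other.\<close>

lemma par_trans:
  assumes "par a b x y" "par a b z w" shows "par x y z w"
proof -
  consider "{a, b, x, y} \<in> B" "{a, b, z, w} \<in> B" | "\<not> {a, b, x, y} \<in> B" | "\<not> {a, b, z, w} \<in> B" by blast
  then show ?thesis
  proof cases
    case 1
    show ?thesis
    proof (cases "{x, y} = {z, w}")
      case True
      then show ?thesis by (auto simp: par_def doubleton_eq_iff)
    next
      case False
      then show ?thesis using lines_symdiff[OF 1] by (simp add: par_def)
    qed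
  next
    case 2
    then consider "a = b" "x = y" | "a = x" "b = y" | "a = y" "b = x" using assms(1) by (auto simp: par_def)
    then show ?thesis
    proof cases
      case 1
      then have "z = w" using assms(2) line_distinct[of a b z w] by (auto simp: par_def)
      then show ?thesis using 1 by (simp add: par_def)
    next
      case 2
      then show ?thesis using assms(2) by simp
    next
      case 3
      then show ?thesis using par_sym(1)[OF assms(2)] by simp
    qed
  next
    case 3
    then consider "a = b" "z = w" | "a = z" "b = w" | "a = w" "b = z" using assms(2) by (auto simp: par_def)
    then show ?thesis
    proof cases
      case 1
      then have "x = y" using assms(1) line_distinct[of a b x y] by (auto simp: par_def)
      then show ?thesis using 1 by (simp add: par_def)
    next
      case 2
      then show ?thesis using par_sym(3)[OF assms(1)] by simp
    next
      case 3
      then show ?thesis using par_sym(3)[OF par_sym(1)[OF assms(1)]] by simp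
    qed
  qed
qed

lemma par_unique: "par a b x y \<Longrightarrow> par a b x z \<Longrightarrow> y = z"
  using par_trans[of a b x y x z] line_distinct[of x y x z] by (auto simp: par_def)

context
  assumes all_col: "\<And>p q r. p \<in> \<Omega> \<Longrightarrow> q \<in> \<Omega> \<Longrightarrow> r \<in> \<Omega> \<Longrightarrow> \<not> ncol p q r"
begin

lemma par_move:
  assumes "a \<in> \<Omega>" "b \<in> \<Omega>" "x \<in> \<Omega>" shows "par a b x (elem_move B a b x)"
proof (cases "a = b")
  case True
  then show ?thesis by (simp add: par_def elem_move_def)
next
  case False
  have "\<not> ncol a b x" using all_col assms by blast
  with False show ?thesis
    by (cases rule: elem_move_collinear_cases) (auto simp: par_def)
qed

text \<open>The sum of \<open>a\<close> and \<open>b\<close> is the image of \<open>b\<close> under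
  \<open>[base, a]\<close>, the fourth vertex of the parallelogram on \<open>base\<close>,
  \<open>a\<close>, \<open>b\<close>. Associativity comes from transitivity of
  \<open>par\<close>.\<close>

lemma affine_space_coordinates:
  "\<exists>\<iota> m. bij_betw \<iota> \<Omega> (F2vec m) \<and> \<iota> base = (\<lambda>_. False) \<and>
    (\<forall>a\<in>\<Omega>. \<forall>b\<in>\<Omega>. \<forall>x\<in>\<Omega>. \<iota> (elem_move B a b x) = \<iota> x \<boxplus> (\<iota> a \<boxplus> \<iota> b))"
proof -
  define f where "f a b = elem_move B base a b" for a b
  have f_in: "f a b \<in> \<Omega>" if "a \<in> \<Omega>" "b \<in> \<Omega>" for a b
    unfolding f_def using that base_in move_in_points by blast
  have f_par: "par base a b (f a b)" if "a \<in> \<Omega>" "b \<in> \<Omega>" for a b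
    unfolding f_def using that base_in par_move by blast
  have comm: "f a b = f b a" if "a \<in> \<Omega>" "b \<in> \<Omega>" for a b
    using par_unique[OF f_par[OF that]] par_sym(2)[OF f_par[OF that(2,1)]] by blast
  have unit: "f base a = a" if "a \<in> \<Omega>" for a
    unfolding f_def by (simp add: elem_move_def)
  have inv: "f a a = base" if "a \<in> \<Omega>" for a
    unfolding f_def by (simp add: elem_move_def)
  have assoc: "f (f a b) c = f a (f b c)" if "a \<in> \<Omega>" "b \<in> \<Omega>" "c \<in> \<Omega>" for a b c
  proof -
    let ?d = "f (f a b) c"
    have 1: "par base c (f a b) ?d" using par_sym(2)[OF f_par[OF f_in[OF that(1,2)] that(3)]] .
    have 2: "par base c b (f b c)" using par_sym(2)[OF f_par[OF that(2,3)]] .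
    have "par b (f b c) (f a b) ?d" by (rule par_trans[OF 2 1])
    then have 3: "par b (f a b) (f b c) ?d" by (rule par_sym(2))
    have "par b (f a b) base a" by (rule par_sym(3)[OF f_par[OF that(1,2)]])
    then have "par base a (f b c) ?d" using 3 by (rule par_trans)
    then show ?thesis using f_par[OF that(1) f_in[OF that(2,3)]] by (rule par_unique)
  qed
  have "\<exists>m h. bij_betw h \<Omega> (F2vec m) \<and> (\<forall>x\<in>\<Omega>. \<forall>y\<in>\<Omega>. h (f x y) = h x \<boxplus> h y)"
    by (rule elementary_abelian_coordinates[OF fin base_in f_in assoc comm unit inv])
  then obtain m h where h: "bij_betw h \<Omega> (F2vec m)"
    and h_add: "\<And>x y. x \<in> \<Omega> \<Longrightarrow> y \<in> \<Omega> \<Longrightarrow> h (f x y) = h x \<boxplus> h y" by blast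
  have "h base = (\<lambda>_. False)" using h_add[OF base_in base_in] unit[OF base_in] by simp
  moreover have "h (elem_move B a b x) = h x \<boxplus> (h a \<boxplus> h b)" if "a \<in> \<Omega>" "b \<in> \<Omega>" "x \<in> \<Omega>" for a b x
  proof -
    let ?y = "elem_move B a b x"
    have y: "?y \<in> \<Omega>" using that move_in_points by blast
    have "par a b base (f a b)"
      using par_sym(2)[OF par_sym(1)[OF f_par[OF that(1,2)]]] .
    then have "par base (f a b) x ?y" using par_move[OF that] by (rule par_trans)
    then have "par x ?y base (f a b)" by (rule par_sym(3))
    moreover have "par x ?y base (f x ?y)"
      using par_sym(2)[OF par_sym(1)[OF f_par[OF that(3) y]]] .
    ultimately have "f a b = f x ?y" by (rule par_unique)
    then have "h a \<boxplus> h b = h x \<boxplus> h ?y" using h_add that y by metis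
    then show ?thesis by simp
  qed
  ultimately show ?thesis using h by (intro exI[of _ h] exI[of _ m]) simp
qed

text \<open>With the zero form every move acts as a translation, and the moves
  \<open>[base, b]\<close> realise all translations.\<close>

lemma affine_case:
  "three_transposition_group (L_group \<Omega> B base) (elem_moves \<Omega> B) \<and>
    (\<exists>m>0. card \<Omega> = 2 ^ m \<and> L_group \<Omega> B base \<cong> F2_group m)"
proof -
  obtain \<iota> m where bij: "bij_betw \<iota> \<Omega> (F2vec m)" and zero: "\<iota> base = (\<lambda>_. False)"
    and move: "\<forall>a\<in>\<Omega>. \<forall>b\<in>\<Omega>. \<forall>x\<in>\<Omega>. \<iota> (elem_move B a b x) = \<iota> x \<boxplus> (\<iota> a \<boxplus> \<iota> b)"
    using affine_space_coordinates by (elim exE conjE)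
  interpret design_rep \<Omega> B base \<iota> "\<lambda>_ _. False"
    using base_in bij move move_in_points elem_move_outside
    by unfold_locales (auto simp: bij_betw_def)
  have card: "card \<Omega> = 2 ^ m" using bij_betw_same_card[OF bij] card_F2vec by simp
  have "m > 0"
  proof (rule ccontr)
    assume "\<not> m > 0"
    then have "card \<Omega> = 1" using card by simp
    then show False using two_points base_in by (auto simp: card_1_singleton_iff)
  qed
  have "affine (move_seq B xs) id" if "set xs \<subseteq> \<Omega>" for xs
    using that
  proof (induction xs rule: induct_list012)
    case (3 a b rest)
    then have ab: "a \<in> \<Omega>" "b \<in> \<Omega>" and rest: "affine (move_seq B (b # rest)) id"
      by (auto simp: id_def)
    have "affine (elem_move B a b) id" using affine_move[OF ab] by (simp add: id_def)
    from affine_comp[OF this rest] show ?case unfolding move_seq.simps comp_id .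
  qed (simp_all only: move_seq.simps affine_id)
  then have "affine g id" if "g \<in> L_inf \<Omega> B base" for g using that by (auto elim!: L_infE)
  then have all: "transl = L_inf \<Omega> B base" by (auto simp: transl_def)
  have "(\<lambda>g. \<iota> (g base)) \<in> iso (G\<lparr>carrier := transl\<rparr>) (F2_group m)"
  proof (rule transl_iso[OF zero])
    show "\<iota> a \<in> F2vec m" if "a \<in> \<Omega>" for a using bij that bij_betwE by blast
    fix v assume "v \<in> F2vec m"
    then obtain b where b: "b \<in> \<Omega>" "v = \<iota> b" using bij by (metis bij_betw_imp_surj_on imageE)
    then show "\<exists>g\<in>transl. \<iota> (g base) = v"
      unfolding all using move_L_inf[OF base_in b(1)] by (intro bexI[of _ "elem_move B base b"]) simp_all
  qed
  moreover have "G\<lparr>carrier := transl\<rparr> = G" unfolding all by (simp add: L_group_def)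
  ultimately have "G \<cong> F2_group m" unfolding is_iso_def by auto
  then show ?thesis using three_transposition card \<open>m > 0\<close> by blast
qed

end

end

theorem theoremB:
  fixes \<Omega> :: "'a set" and B :: "'a set set" and lam :: nat and pinf :: 'a
  assumes "design_2_4 \<Omega> B lam"
    and "supersimple B"
    and "prop_triangle B"
    and "regular_two_graph \<Omega> (collinear_triples B)"
    and "pinf \<in> \<Omega>"
  shows "three_transposition_group (L_group \<Omega> B pinf) (elem_moves \<Omega> B) \<and>
    (\<exists>m::nat. m > 0 \<and>
      ((card \<Omega> = 2 ^ m \<and> L_group \<Omega> B pinf \<cong> F2_group m)
     \<or> ((card \<Omega> = 2 ^ (m - 1) * (2 ^ m + 1) \<or> card \<Omega> = 2 ^ (m - 1) * (2 ^ m - 1))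
          \<and> L_group \<Omega> B pinf \<cong> Sp_group m)
     \<or> (card \<Omega> = 2 ^ (2 * m) \<and> is_2_2m_Sp m (L_group \<Omega> B pinf))))"
proof -
  interpret two_graph_design \<Omega> B pinf
    using assms by unfold_locales (auto simp: design_2_4_def)
  show ?thesis
  proof (cases "\<exists>p\<in>\<Omega>. \<exists>q\<in>\<Omega>. \<exists>r\<in>\<Omega>. ncol p q r")
    case True
    then obtain m \<iota> where "symplectic_rep \<Omega> B pinf \<iota> m" using symplectic_case by blast
    then interpret symplectic_rep \<Omega> B pinf \<iota> m .
    show ?thesis
      by (intro conjI exI[of _ m] three_transposition m_pos disjI2 classification)
  next
    case False
    then have "\<And>p q r. p \<in> \<Omega> \<Longrightarrow> q \<in> \<Omega> \<Longrightarrow> r \<in> \<Omega> \<Longrightarrow> \<not> ncol p q r" by blast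
    note affine = affine_case[OF this]
    then obtain m where "m > 0" "card \<Omega> = 2 ^ m \<and> L_group \<Omega> B pinf \<cong> F2_group m" by auto
    then show ?thesis
      by (intro conjI exI[of _ m] conjunct1[OF affine]) (simp_all only: simp_thms)
  qed
qed

end
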